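(* Let $p\ge 2$ and $m\ge 1$ be integers. Let $A\in\mathbb{C}^{n\times n}$ be a matrix all of whose eigenvalues are in $\{z\in\mathbb{C}: |z-1|<1\}$, and write $A=I-B$. Then, for any matrix norm $\|\cdot\|$ such that $\|B\|<1$, the sequence $\{X_k\}_{k\ge 0}$ generated by Schröder's method for $A^{1/p}$ satisfies $$\|X_k-A^{1/p}\|\le \|B\|^{(m+1)^k}\quad\text{for all } k\ge 0.$$
   Context: $A^{1/p}$ is the principal $p$th root of $A$: the unique matrix $X$ with $X^p=A$ whose eigenvalues all lie in the sector $\{z\ne 0: |\arg z|<\pi/p\}$. A matrix norm is a norm on $\mathbb{C}^{n\times n}$ that is submultiplicative ($\|XY\|\le\|X\|\,\|Y\|$). For real $x$ and integer $i\ge 0$, $(x)_i=x(x+1)\cdots(x+i-1)$, with $(x)_0=1$. Let $b_0=1$, $b_i=\frac{(-1/p)_i}{i!}$ for $i\ge 1$ (the coefficients in $(1-t)^{1/p}=\sum_{i\ge 0} b_i t^i$), and $T_m(t)=\sum_{i=0}^m b_i t^i$. Schröder's method (with parameter $m$) for $A^{1/p}$ is the iteration $X_0=I$, $X_{k+1}=X_k\,T_m(R(X_k))$ with $R(X_k)=I-AX_k^{-p}$, for $k\ge 0$ (for the matrices $A$ considered here all $X_k$ are nonsingular, so the sequence is well defined). *)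

theory Defs
  imports "HOL-Analysis.Analysis"
begin

text \<open>
  The library's powers, norm and scalar multiplication on \<open>complex ^ 'n ^ 'n\<close> are not the
  ones needed here: the type is not an instance of the class \<open>power\<close> for the matrix product,
  its built-in norm is a fixed Euclidean one, and only real scalars act on it by \<open>(*\<^sub>R)\<close>.
\<close>

primrec matrix_pow :: "'a::semiring_1 ^ 'n ^ 'n \<Rightarrow> nat \<Rightarrow> 'a ^ 'n ^ 'n" where
  "matrix_pow X 0 = mat 1"
| "matrix_pow X (Suc k) = X ** matrix_pow X k"

definition matrix_cscale :: "complex \<Rightarrow> complex ^ 'n ^ 'm \<Rightarrow> complex ^ 'n ^ 'm" where
  "matrix_cscale c X = (\<chi> i j. c * X $ i $ j)"

definition eigenvalue :: "complex ^ 'n ^ 'n \<Rightarrow> complex \<Rightarrow> bool" where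
  "eigenvalue X z \<longleftrightarrow> (\<exists>v. v \<noteq> 0 \<and> X *v v = z *s v)"

definition matrix_norm :: "(complex ^ 'n ^ 'n \<Rightarrow> real) \<Rightarrow> bool" where
  "matrix_norm N \<longleftrightarrow>
     (\<forall>X. 0 \<le> N X) \<and>
     (\<forall>X. N X = 0 \<longleftrightarrow> X = 0) \<and>
     (\<forall>c X. N (matrix_cscale c X) = cmod c * N X) \<and>
     (\<forall>X Y. N (X + Y) \<le> N X + N Y) \<and>
     (\<forall>X Y. N (X ** Y) \<le> N X * N Y)"

text \<open>\<open>Arg\<close> takes values in \<open>(-\<pi>, \<pi>]\<close>; since \<open>Arg 0 = 0\<close>, the origin has to be excluded
  from the sector explicitly.\<close>

definition is_principal_root :: "nat \<Rightarrow> complex ^ 'n ^ 'n \<Rightarrow> complex ^ 'n ^ 'n \<Rightarrow> bool" where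
  "is_principal_root p A X \<longleftrightarrow>
     matrix_pow X p = A \<and> (\<forall>z. eigenvalue X z \<longrightarrow> z \<noteq> 0 \<and> \<bar>Arg z\<bar> < pi / real p)"

definition principal_root :: "nat \<Rightarrow> complex ^ 'n ^ 'n \<Rightarrow> complex ^ 'n ^ 'n" where
  "principal_root p A = (THE X. is_principal_root p A X)"

text \<open>The Taylor coefficients of \<open>(1 - t) powr (1/p)\<close> at \<open>t = 0\<close>; they are real, so \<open>(*\<^sub>R)\<close>
  suffices to form the truncated series at a matrix.\<close>

definition root_coeff :: "nat \<Rightarrow> nat \<Rightarrow> real" where
  "root_coeff p i = pochhammer (- 1 / real p) i / fact i"

definition root_taylor :: "nat \<Rightarrow> nat \<Rightarrow> complex ^ 'n ^ 'n \<Rightarrow> complex ^ 'n ^ 'n" where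
  "root_taylor p m Y = (\<Sum>i\<le>m. root_coeff p i *\<^sub>R matrix_pow Y i)"

definition residual :: "nat \<Rightarrow> complex ^ 'n ^ 'n \<Rightarrow> complex ^ 'n ^ 'n \<Rightarrow> complex ^ 'n ^ 'n" where
  "residual p A X = mat 1 - A ** matrix_pow (matrix_inv X) p"

primrec schroeder :: "nat \<Rightarrow> nat \<Rightarrow> complex ^ 'n ^ 'n \<Rightarrow> nat \<Rightarrow> complex ^ 'n ^ 'n" where
  "schroeder p m A 0 = mat 1"
| "schroeder p m A (Suc k) =
     schroeder p m A k ** root_taylor p m (residual p A (schroeder p m A k))"

end

theory Submission
  imports Defs "HOL-Computational_Algebra.Fundamental_Theorem_Algebra"
begin

text \<open>
  For \<open>A = I - B\<close> the iterates are power series \<open>x\<^sub>k(B)\<close>, where \<open>x\<^sub>k(t)\<close> is the iteration for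
  \<open>1 - t\<close>, with residual \<open>R\<^sub>k = 1 - (1 - t) / x\<^sub>k ^ p\<close>. One step composes \<open>R\<^sub>k\<close> with
  \<open>g = 1 - (1 - t) / T ^ p\<close>. Both \<open>g\<close> and \<open>T g = T - (1 - t) T ^ (1 - p)\<close> have nonnegative
  coefficients: the first because \<open>g' = e t ^ m / T ^ (p + 1)\<close> with \<open>e \<ge> 0\<close>, the second because
  the coefficients of \<open>T ^ (1 - p)\<close> decrease. Hence so do \<open>R\<^sub>k\<close> and \<open>x\<^sub>k R\<^sub>k\<close>, and with them
  \<open>x\<^sub>k - x\<^sub>k\<^sub>+\<^sub>1 = x\<^sub>k (1 - T(R\<^sub>k))\<close> and \<open>x\<^sub>k - h = x\<^sub>k (1 - h(R\<^sub>k))\<close>, where \<open>h = (1 - t) powr (1/p)\<close>.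
  So the coefficients of \<open>x\<^sub>k\<close> lie between those of \<open>h\<close> and \<open>0\<close> from index \<open>1\<close> on, and agree with those of
  \<open>h\<close> below index \<open>(m + 1) ^ k\<close>; since the coefficients of \<open>1 - h\<close> sum to at most \<open>1\<close>, the bound follows.
\<close>

section \<open>Power series with nonnegative coefficients and the binomial series\<close>

notation fps_nth (infixl "$$" 75)

definition coeffs_nonneg :: "real fps \<Rightarrow> bool" where
  "coeffs_nonneg F \<longleftrightarrow> (\<forall>n. 0 \<le> F $$ n)"

lemma coeffs_nonnegD: "coeffs_nonneg F \<Longrightarrow> 0 \<le> F $$ n"
  by (simp add: coeffs_nonneg_def)

lemma coeffs_nonneg_one [simp]: "coeffs_nonneg 1"
  by (simp add: coeffs_nonneg_def)

lemma coeffs_nonneg_fps_X [simp]: "coeffs_nonneg fps_X"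
  by (simp add: coeffs_nonneg_def fps_X_def)

lemma coeffs_nonneg_mult: "coeffs_nonneg F \<Longrightarrow> coeffs_nonneg G \<Longrightarrow> coeffs_nonneg (F * G)"
  by (auto simp: coeffs_nonneg_def fps_mult_nth intro!: sum_nonneg)

lemma coeffs_nonneg_power: "coeffs_nonneg F \<Longrightarrow> coeffs_nonneg (F ^ k)"
  by (induction k) (auto intro: coeffs_nonneg_mult)

lemma coeffs_nonneg_compose: "coeffs_nonneg F \<Longrightarrow> coeffs_nonneg G \<Longrightarrow> coeffs_nonneg (F oo G)"
  using coeffs_nonneg_power[of G]
  by (auto simp: coeffs_nonneg_def fps_compose_nth intro!: sum_nonneg)

text \<open>Comparing coefficients in \<open>F * inverse F = 1\<close> writes each later coefficient
  of the inverse as a combination of earlier ones with nonnegative weights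
  \<open>- F $$ i\<close>.\<close>

lemma coeffs_nonneg_inverse:
  assumes "F $$ 0 = 1" and "\<And>n. 0 < n \<Longrightarrow> F $$ n \<le> 0"
  shows "coeffs_nonneg (inverse F)"
  unfolding coeffs_nonneg_def
proof
  fix n
  show "0 \<le> inverse F $$ n"
  proof (induction n rule: less_induct)
    case (less n)
    show ?case
    proof (cases "n = 0")
      case True
      then show ?thesis using assms by simp
    next
      case False
      have "0 = (F * inverse F) $$ n"
        using False assms(1) by (simp add: inverse_mult_eq_1')
      also have "\<dots> = inverse F $$ n + (\<Sum>i=1..n. F $$ i * inverse F $$ (n - i))"
        using assms(1) by (simp add: fps_mult_nth sum.atLeast_Suc_atMost del: fps_mult_nth_0)
      finally have "inverse F $$ n = (\<Sum>i=1..n. - F $$ i * inverse F $$ (n - i))"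
        by (simp add: sum_negf)
      also have "0 \<le> \<dots>"
        using assms(2) less.IH by (intro sum_nonneg) (auto intro!: mult_nonneg_nonneg mult_nonpos_nonneg)
      finally show ?thesis .
    qed
  qed
qed

lemma one_minus_fps_X_mult_nth:
  "((1 - fps_X) * (F :: real fps)) $$ n = F $$ n - (if n = 0 then 0 else F $$ (n - 1))"
  by (simp add: left_diff_distrib)

text \<open>A factor \<open>fps_X\<close> split off before composition becomes a factor
  \<open>residual_fps k\<close> afterwards, which can then be paired with the iterate.\<close>

lemma coeffs_nonneg_eq_fps_X_mult:
  assumes "coeffs_nonneg F" and "F $$ 0 = 0"
  obtains G where "coeffs_nonneg G" and "F = fps_X * G"
proof
  show "coeffs_nonneg (fps_shift 1 F)"
    using assms by (simp add: coeffs_nonneg_def)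
  show "F = fps_X * fps_shift 1 F"
    using assms(2) by (simp add: fps_eq_iff)
qed

lemma fps_X_power_dvdI:
  fixes F :: "real fps"
  assumes "\<And>i. i < n \<Longrightarrow> F $$ i = 0"
  shows "fps_X ^ n dvd F"
proof
  show "F = fps_X ^ n * fps_shift n F"
    using assms by (simp add: fps_eq_iff fps_X_power_mult_nth)
qed

lemma fps_X_power_dvdD: "fps_X ^ n dvd (F :: real fps) \<Longrightarrow> i < n \<Longrightarrow> F $$ i = 0"
  by (auto simp: dvd_def fps_X_power_mult_nth)

text \<open>Orders multiply under composition; this is the source of the exponent
  \<open>(m + 1) ^ k\<close>.\<close>

lemma fps_X_power_dvd_compose:
  fixes F G :: "real fps"
  assumes "fps_X ^ a dvd F" and "fps_X ^ b dvd G" and "G $$ 0 = 0"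
  shows "fps_X ^ (a * b) dvd F oo G"
proof -
  obtain K where "F = fps_X ^ a * K" using assms(1) by blast
  then have "F oo G = G ^ a * (K oo G)"
    using assms(3) by (simp add: fps_compose_mult_distrib fps_X_power_compose)
  moreover have "fps_X ^ (a * b) dvd G ^ a"
    using assms(2) by (metis dvd_power_same power_mult mult.commute)
  ultimately show ?thesis by simp
qed

text \<open>In \<open>F ^ p - G ^ p = (F - G) * ?S\<close> the cofactor has constant coefficient
  \<open>p\<close>, so it is nonzero, and real power series have no zero divisors.\<close>

lemma fps_power_eq_imp_eq:
  fixes F G :: "real fps"
  assumes "F ^ p = G ^ p" and "0 < p" and "F $$ 0 = 1" and "G $$ 0 = 1"
  shows "F = G"
proof -
  let ?S = "\<Sum>i<p. G ^ (p - Suc i) * F ^ i"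
  have "?S $$ 0 = (\<Sum>i<p. 1)"
    unfolding fps_sum_nth using assms(3,4) by (intro sum.cong) (auto simp: fps_nth_power_0)
  then have "?S \<noteq> 0" using assms(2) by auto
  moreover have "(F - G) * ?S = 0"
    using power_diff_sumr2[of F p G] assms(1) by simp
  ultimately show ?thesis by simp
qed

section \<open>The coefficients of \<open>(1 - t) powr (1/p)\<close>: signs, partial sums, p-th
  power\<close>

lemma root_coeff_0 [simp]: "root_coeff p 0 = 1"
  by (simp add: root_coeff_def)

lemma root_coeff_Suc:
  "root_coeff p (Suc n) * real (Suc n) = root_coeff p n * (real n - 1 / real p)"
  by (simp add: root_coeff_def pochhammer_Suc divide_simps del: of_nat_Suc)

lemma root_coeff_neg:
  assumes "2 \<le> p" and "0 < n"
  shows "root_coeff p n < 0"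
  using assms(2)
proof (induction n rule: nat_induct_non_zero)
  case 1
  then show ?case using assms(1) by (simp add: root_coeff_def)
next
  case (Suc n)
  have "1 / real p \<le> 1 / 2" using assms(1) by (intro divide_left_mono) auto
  then have "1 / real p < real n" using Suc.hyps by linarith
  then have "root_coeff p (Suc n) * real (Suc n) < 0"
    unfolding root_coeff_Suc using Suc.IH by (simp add: mult_neg_pos)
  then show ?case by (simp add: mult_less_0_iff)
qed

text \<open>Summing coefficients means dividing the series by \<open>1 - t\<close>, so these are the
  coefficients of \<open>(1 - t) powr (1/p - 1)\<close>.\<close>

lemma sum_root_coeff: "(\<Sum>i\<le>n. root_coeff p i) = pochhammer (1 - 1 / real p) n / fact n"
proof (induction n)
  case (Suc n)
  define q where "q = 1 / real p"
  have "root_coeff p (Suc n) = - q * pochhammer (1 - q) n / fact (Suc n)"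
    by (simp add: root_coeff_def pochhammer_rec q_def)
  then show ?case
    using Suc unfolding q_def[symmetric] by (simp add: pochhammer_Suc divide_simps) (simp add: algebra_simps)
qed simp

lemma sum_root_coeff_nonneg:
  assumes "2 \<le> p"
  shows "0 \<le> (\<Sum>i\<le>n. root_coeff p i)"
  unfolding sum_root_coeff using assms
  by (intro divide_nonneg_pos pochhammer_nonneg) (auto simp: field_simps)

text \<open>All coefficients after the first are negative while the partial sums stay nonnegative,
  so their total size never exceeds the leading \<open>1\<close>.\<close>

lemma sum_neg_root_coeff_le_1:
  assumes "2 \<le> p" and "finite S" and "0 \<notin> S"
  shows "(\<Sum>i\<in>S. - root_coeff p i) \<le> 1"
proof -
  obtain n where n: "S \<subseteq> {..n}" using assms(2) finite_nat_set_iff_bounded_le by auto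
  have "(\<Sum>i\<in>S. - root_coeff p i) \<le> (\<Sum>i\<in>{0<..n}. - root_coeff p i)"
    using n assms(1,3) root_coeff_neg[of p]
    by (intro sum_mono2) (auto simp: less_imp_le intro: gr0I)
  moreover have "(\<Sum>i\<le>n. root_coeff p i) = 1 + (\<Sum>i\<in>{0<..n}. root_coeff p i)"
  proof -
    have "{..n} = insert 0 {0<..n}" by auto
    then show ?thesis by simp
  qed
  ultimately show ?thesis
    using sum_root_coeff_nonneg[OF assms(1), of n] by (simp add: sum_negf)
qed

definition root_series :: "nat \<Rightarrow> real fps" where
  "root_series p = Abs_fps (root_coeff p)"

definition root_trunc :: "nat \<Rightarrow> nat \<Rightarrow> real fps" where
  "root_trunc p m = Abs_fps (\<lambda>n. if n \<le> m then root_coeff p n else 0)"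

lemma root_series_nth [simp]: "root_series p $$ n = root_coeff p n"
  by (simp add: root_series_def)

lemma root_trunc_nth [simp]: "root_trunc p m $$ n = (if n \<le> m then root_coeff p n else 0)"
  by (simp add: root_trunc_def)

text \<open>The coefficient recurrence says \<open>p (1 - t) h' = - h\<close>. Hence
  \<open>G = h ^ p\<close> satisfies \<open>(1 - t) G' = - G\<close>, whose solution with constant
  term \<open>1\<close> is \<open>1 - t\<close>.\<close>

lemma root_series_power:
  assumes "0 < p"
  shows "root_series p ^ p = 1 - fps_X"
proof -
  define h where "h = root_series p"
  define G where "G = h ^ p"
  have h': "fps_const (real p) * ((1 - fps_X) * fps_deriv h) = - h"
  proof (rule fps_ext)
    fix n
    show "(fps_const (real p) * ((1 - fps_X) * fps_deriv h)) $$ n = (- h) $$ n"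
      using root_coeff_Suc[of p n] assms
      by (cases n) (auto simp: h_def one_minus_fps_X_mult_nth fps_mult_left_const_nth field_simps)
  qed
  have "(1 - fps_X) * fps_deriv G = h ^ (p - 1) * (fps_const (real p) * ((1 - fps_X) * fps_deriv h))"
    by (simp add: G_def fps_deriv_power fps_of_nat algebra_simps)
  also have "\<dots> = - G"
    unfolding h' using assms by (simp add: G_def flip: power_Suc2)
  finally have G': "((1 - fps_X) * fps_deriv G) $$ n = - G $$ n" for n by simp
  have rec: "real (Suc n) * G $$ Suc n = (real n - 1) * G $$ n" for n
    using G'[of n] unfolding one_minus_fps_X_mult_nth
    by (cases n) (auto simp: algebra_simps)
  have G0: "G $$ 0 = 1" by (simp add: G_def h_def fps_nth_power_0)
  have G1: "G $$ 1 = -1" using rec[of 0] G0 by simp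
  \<comment> \<open>The factor \<open>real n - 1\<close> in the recurrence vanishes at
    \<open>n = 1\<close>, which annihilates the coefficient at index \<open>2\<close> and with it
    all later ones.\<close>
  have G2: "G $$ Suc (Suc n) = 0" for n
  proof (induction n)
    case 0
    then show ?case using rec[of 1] by simp
  next
    case (Suc n)
    then show ?case using rec[of "Suc (Suc n)"] by simp
  qed
  have "G = 1 - fps_X"
  proof (rule fps_ext)
    fix n
    show "G $$ n = (1 - fps_X) $$ n"
      using G0 G1 G2[of "n - 2"]
      by (cases "n = 0"; cases "n = 1") (auto simp: numeral_2_eq_2 fps_X_def Suc_diff_Suc)
  qed
  then show ?thesis by (simp add: G_def h_def)
qed

section \<open>The iteration on formal power series\<close>

locale root_params =
  fixes p m :: nat
  assumes p_ge_2: "2 \<le> p" and m_ge_1: "1 \<le> m"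
begin

abbreviation "T \<equiv> root_trunc p m"

definition "inv_trunc = inverse T"

text \<open>One step of the method replaces the residual \<open>R\<close> by \<open>step_residual oo R\<close>.\<close>

definition "step_residual = 1 - (1 - fps_X) * inv_trunc ^ p"

lemma T_mult_inv_trunc: "T * inv_trunc = 1"
  by (simp add: inv_trunc_def inverse_mult_eq_1')

lemma inv_trunc_nth_0 [simp]: "inv_trunc $$ 0 = 1"
  by (simp add: inv_trunc_def)

lemma coeffs_nonneg_inv_trunc: "coeffs_nonneg inv_trunc"
  unfolding inv_trunc_def using root_coeff_neg[OF p_ge_2]
  by (intro coeffs_nonneg_inverse) (auto simp: less_imp_le)

text \<open>\<open>(1 - t) powr (1/p)\<close> satisfies this differential equation with right-hand side \<open>0\<close>;
  truncation leaves only the top coefficient.\<close>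

lemma deriv_T:
  "T + fps_const (real p) * ((1 - fps_X) * fps_deriv T)
     = fps_const (root_coeff p m * (1 - real p * real m)) * fps_X ^ m"
proof (rule fps_ext)
  fix n
  have "real p \<noteq> 0" using p_ge_2 by simp
  then show "(T + fps_const (real p) * ((1 - fps_X) * fps_deriv T)) $$ n
     = (fps_const (root_coeff p m * (1 - real p * real m)) * fps_X ^ m) $$ n"
    using root_coeff_Suc[of p n] m_ge_1
    by (cases n) (auto simp: one_minus_fps_X_mult_nth field_simps)
qed

lemma deriv_inv_trunc: "fps_deriv inv_trunc = - fps_deriv T * inv_trunc ^ 2"
  unfolding inv_trunc_def by (rule fps_inverse_deriv) simp

text \<open>The derivative is \<open>(T + p (1 - t) T') / T ^ (p + 1)\<close>, and
  \<open>deriv_T\<close> collapses the numerator to a monomial. Signs and order of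
  \<open>step_residual\<close> are read off from this form.\<close>

lemma deriv_step_residual:
  "fps_deriv step_residual
     = fps_const (root_coeff p m * (1 - real p * real m)) * fps_X ^ m * inv_trunc ^ Suc p"
proof -
  have "inv_trunc ^ 2 * inv_trunc ^ (p - 1) = inv_trunc ^ Suc p"
    using p_ge_2 by (simp only: power_add[symmetric]) simp
  then have "fps_deriv (inv_trunc ^ p) = - (fps_const (real p) * fps_deriv T * inv_trunc ^ Suc p)"
    by (simp add: fps_deriv_power deriv_inv_trunc fps_of_nat mult.assoc del: power_Suc)
  then have "fps_deriv step_residual
      = inv_trunc ^ p + fps_const (real p) * ((1 - fps_X) * fps_deriv T) * inv_trunc ^ Suc p"
    by (simp add: step_residual_def algebra_simps)
  also have "inv_trunc ^ p = T * inv_trunc ^ Suc p"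
    using T_mult_inv_trunc by (simp add: mult.assoc[symmetric])
  finally show ?thesis
    unfolding deriv_T[symmetric] by (simp add: algebra_simps)
qed

lemma step_residual_nth_0 [simp]: "step_residual $$ 0 = 0"
  by (simp add: step_residual_def fps_nth_power_0)

lemma coeffs_nonneg_step_residual: "coeffs_nonneg step_residual"
  unfolding coeffs_nonneg_def
proof
  fix n
  show "0 \<le> step_residual $$ n"
  proof (cases n)
    case (Suc k)
    have "1 * 1 \<le> real p * real m" using p_ge_2 m_ge_1 by (intro mult_mono) auto
    \<comment> \<open>A product of two nonpositive factors; the first is negative because
      \<open>m \<ge> 1\<close>.\<close>
    then have "0 \<le> root_coeff p m * (1 - real p * real m)" (is "0 \<le> ?c")
      using root_coeff_neg[OF p_ge_2, of m] m_ge_1 by (intro mult_nonpos_nonpos) auto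
    moreover have "0 \<le> (fps_X ^ m * inv_trunc ^ Suc p) $$ k"
      by (intro coeffs_nonnegD coeffs_nonneg_mult coeffs_nonneg_power coeffs_nonneg_inv_trunc) simp
    ultimately have "0 \<le> ?c * (fps_X ^ m * inv_trunc ^ Suc p) $$ k"
      by (rule mult_nonneg_nonneg)
    then have "0 \<le> fps_deriv step_residual $$ k"
      unfolding deriv_step_residual mult.assoc[of "fps_const _"] fps_mult_left_const_nth .
    then show ?thesis using Suc by (simp add: zero_le_mult_iff)
  qed simp
qed

lemma fps_X_power_dvd_step_residual: "fps_X ^ Suc m dvd step_residual"
proof (rule fps_X_power_dvdI)
  fix n
  assume "n < Suc m"
  then show "step_residual $$ n = 0"
  proof (cases n)
    case (Suc k)
    then have "fps_deriv step_residual $$ k = 0"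
      unfolding deriv_step_residual mult.assoc fps_mult_left_const_nth fps_X_power_mult_nth
      using \<open>n < Suc m\<close> by simp
    then show ?thesis using Suc by (simp del: of_nat_Suc)
  qed simp
qed

section \<open>Monotonicity of the coefficients of \<open>T ^ (1 - p)\<close>\<close>

definition "inv_trunc_pow = inv_trunc ^ (p - 1)"

text \<open>Beyond the degree of \<open>T\<close>, coefficient \<open>n\<close> on the right is the
  drop of \<open>inv_trunc_pow\<close> from index \<open>n - 1\<close> to \<open>n\<close>, so
  nonnegativity reduces to monotonicity.\<close>

lemma T_mult_step_residual: "T * step_residual = T - (1 - fps_X) * inv_trunc_pow"
proof -
  have "inv_trunc ^ p = inv_trunc * inv_trunc_pow" using p_ge_2 by (simp add: inv_trunc_pow_def flip: power_Suc)
  then have "T * step_residual = T - (1 - fps_X) * (T * inv_trunc) * inv_trunc_pow"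
    by (simp add: step_residual_def algebra_simps)
  then show ?thesis by (simp add: T_mult_inv_trunc)
qed

lemma T_mult_deriv_inv_trunc_pow: "T * fps_deriv inv_trunc_pow = - (fps_const (real p - 1) * fps_deriv T * inv_trunc_pow)"
proof -
  have "inv_trunc ^ 2 * inv_trunc ^ (p - 1 - 1) = inv_trunc ^ p"
    using p_ge_2 by (simp only: power_add[symmetric] diff_diff_left one_add_one le_add_diff_inverse)
  moreover have "inv_trunc ^ p = inv_trunc * inv_trunc_pow"
    using p_ge_2 by (simp add: inv_trunc_pow_def flip: power_Suc)
  moreover have "real (p - 1) = real p - 1"
    using p_ge_2 by simp
  ultimately have "fps_deriv inv_trunc_pow = - (fps_const (real p - 1) * fps_deriv T * (inv_trunc * inv_trunc_pow))"
    by (simp only: inv_trunc_pow_def fps_deriv_power deriv_inv_trunc mult.assoc mult_minus_left mult_minus_right)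
  then have "T * fps_deriv inv_trunc_pow = - (fps_const (real p - 1) * fps_deriv T * (T * inv_trunc) * inv_trunc_pow)"
    by (simp add: algebra_simps)
  then show ?thesis by (simp add: T_mult_inv_trunc)
qed

text \<open>Multiplying \<open>T_mult_deriv_inv_trunc_pow\<close> by \<open>fps_X\<close> turns
  differentiation into multiplication of coefficient \<open>n\<close> by \<open>n\<close>. The
  weight is \<open>(n - i) + (p - 1) i\<close>.\<close>

lemma inv_trunc_pow_recurrence:
  "(\<Sum>i=0..n. T $$ i * ((real n + (real p - 2) * real i) * inv_trunc_pow $$ (n - i))) = 0"
proof -
  have X: "fps_X * fps_deriv F = Abs_fps (\<lambda>n. real n * F $$ n)" for F :: "real fps"
    by (rule fps_ext) (simp add: algebra_simps)
  have "T * (fps_X * fps_deriv inv_trunc_pow) + fps_const (real p - 1) * ((fps_X * fps_deriv T) * inv_trunc_pow) = 0"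
    using arg_cong[OF T_mult_deriv_inv_trunc_pow, of "\<lambda>F. fps_X * F"] by (simp add: algebra_simps)
  then have "0 = (T * (fps_X * fps_deriv inv_trunc_pow) + fps_const (real p - 1) * ((fps_X * fps_deriv T) * inv_trunc_pow)) $$ n"
    by simp
  also have "\<dots> = (\<Sum>i=0..n. T $$ i * (real (n - i) * inv_trunc_pow $$ (n - i)))
      + (\<Sum>i=0..n. (real p - 1) * (real i * T $$ i * inv_trunc_pow $$ (n - i)))"
    unfolding X fps_add_nth fps_mult_left_const_nth by (simp only: fps_mult_nth sum_distrib_left fps_nth_Abs_fps)
  also have "\<dots> = (\<Sum>i=0..n. T $$ i * (real (n - i) * inv_trunc_pow $$ (n - i))
      + (real p - 1) * (real i * T $$ i * inv_trunc_pow $$ (n - i)))"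
    by (simp only: sum.distrib)
  also have "\<dots> = (\<Sum>i=0..n. T $$ i * ((real n + (real p - 2) * real i) * inv_trunc_pow $$ (n - i)))"
  proof (rule sum.cong[OF refl])
    fix i
    assume "i \<in> {0..n}"
    then have "real (n - i) = real n - real i" by (simp add: of_nat_diff)
    then show "T $$ i * (real (n - i) * inv_trunc_pow $$ (n - i)) + (real p - 1) * (real i * T $$ i * inv_trunc_pow $$ (n - i))
        = T $$ i * ((real n + (real p - 2) * real i) * inv_trunc_pow $$ (n - i))"
      by (simp add: algebra_simps del: root_trunc_nth)
  qed
  finally show ?thesis by simp
qed

text \<open>From \<open>n = m\<close> on, all of \<open>T\<close> takes part, so the range of
  summation no longer depends on \<open>n\<close>. Since \<open>p \<ge> 2\<close>, the weights are
  nonnegative and do not increase with \<open>n\<close>.\<close>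

lemma inv_trunc_pow_nth:
  assumes "m \<le> n"
  shows "inv_trunc_pow $$ n = (\<Sum>i=1..m. - root_coeff p i
        * ((1 + (real p - 2) * real i / real n) * inv_trunc_pow $$ (n - i)))"
proof -
  have n: "0 < n" using assms m_ge_1 by simp
  have "0 = (\<Sum>i=0..n. T $$ i * ((real n + (real p - 2) * real i) * inv_trunc_pow $$ (n - i)))"
    by (rule inv_trunc_pow_recurrence[symmetric])
  also have "\<dots> = (\<Sum>i=0..m. root_coeff p i * ((real n + (real p - 2) * real i) * inv_trunc_pow $$ (n - i)))"
    using assms by (intro sum.mono_neutral_cong_right) auto
  also have "\<dots> = real n * inv_trunc_pow $$ n
      + (\<Sum>i=1..m. root_coeff p i * ((real n + (real p - 2) * real i) * inv_trunc_pow $$ (n - i)))"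
    by (simp add: sum.atLeast_Suc_atMost)
  finally have "real n * inv_trunc_pow $$ n
      = (\<Sum>i=1..m. - root_coeff p i * ((real n + (real p - 2) * real i) * inv_trunc_pow $$ (n - i)))"
    by (simp add: sum_negf)
  also have "\<dots> = real n * (\<Sum>i=1..m. - root_coeff p i
        * ((1 + (real p - 2) * real i / real n) * inv_trunc_pow $$ (n - i)))"
    unfolding sum_distrib_left using n by (intro sum.cong) (auto simp: field_simps)
  finally show ?thesis using n by simp
qed

lemma coeffs_nonneg_inv_trunc_pow: "coeffs_nonneg inv_trunc_pow"
  unfolding inv_trunc_pow_def by (rule coeffs_nonneg_power[OF coeffs_nonneg_inv_trunc])

text \<open>The weights in the recurrence decrease with \<open>n\<close>, so monotonicity propagates beyond index \<open>m\<close>;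
  up to \<open>m\<close> it is forced by \<open>step_residual = O(t ^ Suc m)\<close>.\<close>

lemma inv_trunc_pow_decreasing: "inv_trunc_pow $$ Suc n \<le> inv_trunc_pow $$ n"
proof (induction n rule: less_induct)
  case (less n)
  show ?case
  proof (cases "n < m")
    case True
    then have "(T * step_residual) $$ Suc n = 0"
      using fps_X_power_dvdD[OF dvd_mult[OF fps_X_power_dvd_step_residual]] by simp
    then have "inv_trunc_pow $$ Suc n - inv_trunc_pow $$ n = root_coeff p (Suc n)"
      using True unfolding T_mult_step_residual by (simp add: one_minus_fps_X_mult_nth)
    then show ?thesis using root_coeff_neg[OF p_ge_2, of "Suc n"] by simp
  next
    case False
    then have n: "m \<le> n" "0 < n" using m_ge_1 by auto
    have "inv_trunc_pow $$ Suc n = (\<Sum>i=1..m. - root_coeff p i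
        * ((1 + (real p - 2) * real i / real (Suc n)) * inv_trunc_pow $$ (Suc n - i)))"
      using n by (intro inv_trunc_pow_nth) simp
    also have "\<dots> \<le> (\<Sum>i=1..m. - root_coeff p i
        * ((1 + (real p - 2) * real i / real n) * inv_trunc_pow $$ (n - i)))"
    proof (intro sum_mono mult_left_mono mult_mono)
      fix i
      assume i: "i \<in> {1..m}"
      show "1 + (real p - 2) * real i / real (Suc n) \<le> 1 + (real p - 2) * real i / real n"
        using p_ge_2 n by (intro add_left_mono divide_left_mono mult_nonneg_nonneg) auto
      \<comment> \<open>Here \<open>i \<ge> 1\<close> brings \<open>n - i\<close> within the
        induction hypothesis, and \<open>i \<le> m \<le> n\<close> excludes truncated
        subtraction.\<close>
      show "inv_trunc_pow $$ (Suc n - i) \<le> inv_trunc_pow $$ (n - i)"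
        using less.IH[of "n - i"] i n by (simp add: Suc_diff_le)
      show "0 \<le> 1 + (real p - 2) * real i / real n"
        using p_ge_2 by (intro add_nonneg_nonneg divide_nonneg_nonneg mult_nonneg_nonneg) auto
      show "0 \<le> inv_trunc_pow $$ (Suc n - i)" by (rule coeffs_nonnegD[OF coeffs_nonneg_inv_trunc_pow])
      show "0 \<le> - root_coeff p i" using root_coeff_neg[OF p_ge_2, of i] i by simp
    qed
    also have "\<dots> = inv_trunc_pow $$ n" using n by (intro inv_trunc_pow_nth[symmetric]) simp
    finally show ?thesis .
  qed
qed

lemma coeffs_nonneg_T_mult_step_residual: "coeffs_nonneg (T * step_residual)"
  unfolding coeffs_nonneg_def
proof
  fix n
  show "0 \<le> (T * step_residual) $$ n"
  proof (cases "n \<le> m")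
    case True
    then show ?thesis
      using fps_X_power_dvdD[OF dvd_mult[OF fps_X_power_dvd_step_residual]] by simp
  next
    case False
    then show ?thesis
      using inv_trunc_pow_decreasing[of "n - 1"] unfolding T_mult_step_residual
      by (simp add: one_minus_fps_X_mult_nth)
  qed
qed

section \<open>Iterates and residuals for \<open>1 - t\<close>\<close>

primrec schroeder_fps :: "nat \<Rightarrow> real fps" where
  "schroeder_fps 0 = 1"
| "schroeder_fps (Suc k) = schroeder_fps k * (T oo (1 - (1 - fps_X) * inverse (schroeder_fps k) ^ p))"

definition "residual_fps k = 1 - (1 - fps_X) * inverse (schroeder_fps k) ^ p"

lemma schroeder_fps_Suc: "schroeder_fps (Suc k) = schroeder_fps k * (T oo residual_fps k)"
  by (simp add: residual_fps_def)

declare schroeder_fps.simps(2) [simp del]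

lemma schroeder_fps_nth_0 [simp]: "schroeder_fps k $$ 0 = 1"
  by (induction k) (simp_all add: schroeder_fps_Suc)

lemma residual_fps_nth_0 [simp]: "residual_fps k $$ 0 = 0"
  by (simp add: residual_fps_def fps_nth_power_0)

lemma residual_fps_0: "residual_fps 0 = fps_X"
  by (simp add: residual_fps_def)

text \<open>With \<open>x_k\<close> and \<open>R_k\<close> for iterate and residual,
  \<open>(1 - t) / x_(k+1) ^ p\<close> equals \<open>((1 - t) / x_k ^ p) / T(R_k) ^ p\<close>, whose
  numerator is \<open>1 - R_k\<close>.\<close>

lemma residual_fps_Suc: "residual_fps (Suc k) = step_residual oo residual_fps k"
proof -
  have "step_residual oo residual_fps k = 1 - (1 - residual_fps k) * inverse (T oo residual_fps k) ^ p"
    by (simp add: step_residual_def inv_trunc_def fps_compose_sub_distrib fps_compose_mult_distrib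
        fps_compose_power[symmetric] fps_inverse_compose)
  also have "\<dots> = residual_fps (Suc k)"
    unfolding residual_fps_def[of "Suc k"] schroeder_fps_Suc fps_inverse_mult power_mult_distrib
    by (simp add: residual_fps_def mult.assoc)
  finally show ?thesis ..
qed

lemma coeffs_nonneg_residual_fps: "coeffs_nonneg (residual_fps k)"
  by (induction k)
    (auto simp: residual_fps_0 residual_fps_Suc intro: coeffs_nonneg_compose coeffs_nonneg_step_residual)

lemma fps_X_power_dvd_residual_fps: "fps_X ^ ((m + 1) ^ k) dvd residual_fps k"
proof (induction k)
  case (Suc k)
  then show ?case
    using fps_X_power_dvd_compose[OF fps_X_power_dvd_step_residual Suc] by (simp add: residual_fps_Suc)
qed (simp add: residual_fps_0)

text \<open>The iterate alone may have negative coefficients, so the product is carried through the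
  induction: with \<open>T * step_residual = t G\<close> it is multiplied by \<open>G(R_k)\<close>
  in each step.\<close>

lemma coeffs_nonneg_schroeder_fps_mult_residual_fps: "coeffs_nonneg (schroeder_fps k * residual_fps k)"
proof (induction k)
  case 0
  then show ?case by (simp add: residual_fps_0)
next
  case (Suc k)
  obtain G where G: "coeffs_nonneg G" "T * step_residual = fps_X * G"
    using coeffs_nonneg_eq_fps_X_mult[OF coeffs_nonneg_T_mult_step_residual] by auto
  have "schroeder_fps (Suc k) * residual_fps (Suc k) = schroeder_fps k * ((T * step_residual) oo residual_fps k)"
    by (simp add: schroeder_fps_Suc residual_fps_Suc fps_compose_mult_distrib mult.assoc)
  also have "\<dots> = schroeder_fps k * residual_fps k * (G oo residual_fps k)"
    by (simp add: G fps_compose_mult_distrib mult.assoc)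
  finally have "schroeder_fps (Suc k) * residual_fps (Suc k) = schroeder_fps k * residual_fps k * (G oo residual_fps k)" .
  moreover have "coeffs_nonneg (schroeder_fps k * residual_fps k * (G oo residual_fps k))"
    by (intro coeffs_nonneg_mult Suc coeffs_nonneg_compose G(1) coeffs_nonneg_residual_fps)
  ultimately show ?case by (simp only:)
qed

text \<open>The choice \<open>F = T\<close> yields the difference of consecutive iterates,
  \<open>F = root_series p\<close> the error. With \<open>1 - F = t G\<close> the series in question
  is \<open>x_k R_k G(R_k)\<close>.\<close>

lemma schroeder_fps_minus_schroeder_fps_mult_compose:
  assumes "F $$ 0 = 1" and "\<And>n. 0 < n \<Longrightarrow> F $$ n \<le> 0"
  shows "coeffs_nonneg (schroeder_fps k - schroeder_fps k * (F oo residual_fps k))"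
    and "fps_X ^ ((m + 1) ^ k) dvd schroeder_fps k - schroeder_fps k * (F oo residual_fps k)"
proof -
  have "coeffs_nonneg (1 - F)" using assms by (simp add: coeffs_nonneg_def fps_one_nth)
  then obtain G where G: "coeffs_nonneg G" "1 - F = fps_X * G"
    by (rule coeffs_nonneg_eq_fps_X_mult) (use assms in simp_all)
  have "schroeder_fps k - schroeder_fps k * (F oo residual_fps k) = schroeder_fps k * ((1 - F) oo residual_fps k)"
    by (simp add: fps_compose_sub_distrib right_diff_distrib)
  also have "\<dots> = schroeder_fps k * residual_fps k * (G oo residual_fps k)"
    by (simp add: G fps_compose_mult_distrib mult.assoc)
  finally have eq: "schroeder_fps k - schroeder_fps k * (F oo residual_fps k) = schroeder_fps k * residual_fps k * (G oo residual_fps k)" .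
  show "coeffs_nonneg (schroeder_fps k - schroeder_fps k * (F oo residual_fps k))"
    unfolding eq
    by (intro coeffs_nonneg_mult coeffs_nonneg_schroeder_fps_mult_residual_fps coeffs_nonneg_compose G(1) coeffs_nonneg_residual_fps)
  show "fps_X ^ ((m + 1) ^ k) dvd schroeder_fps k - schroeder_fps k * (F oo residual_fps k)"
    unfolding eq by (intro dvd_mult2[OF dvd_mult] fps_X_power_dvd_residual_fps)
qed

text \<open>Both sides have constant coefficient \<open>1\<close> and, as
  \<open>x_k ^ p (1 - R_k) = 1 - t\<close>, the same p-th power.\<close>

lemma root_series_eq: "root_series p = schroeder_fps k * (root_series p oo residual_fps k)"
proof (rule fps_power_eq_imp_eq)
  have p: "0 < p" using p_ge_2 by simp
  have "(schroeder_fps k * (root_series p oo residual_fps k)) ^ p = schroeder_fps k ^ p * (1 - residual_fps k)"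
    using p by (simp add: power_mult_distrib fps_compose_power root_series_power fps_compose_sub_distrib)
  also have "\<dots> = (schroeder_fps k * inverse (schroeder_fps k)) ^ p * (1 - fps_X)"
    by (simp add: residual_fps_def power_mult_distrib)
  also have "\<dots> = 1 - fps_X"
    by (simp add: inverse_mult_eq_1')
  finally show "root_series p ^ p = (schroeder_fps k * (root_series p oo residual_fps k)) ^ p"
    using p by (simp add: root_series_power)
qed (use p_ge_2 in simp_all)

lemma root_coeff_le_schroeder_fps_nth: "root_coeff p n \<le> schroeder_fps k $$ n"
  and schroeder_fps_nth_eq_root_coeff: "n < (m + 1) ^ k \<Longrightarrow> schroeder_fps k $$ n = root_coeff p n"
proof -
  have le: "root_series p $$ n \<le> 0" if "0 < n" for n
    using root_coeff_neg[OF p_ge_2 that] by simp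
  note * = schroeder_fps_minus_schroeder_fps_mult_compose[of "root_series p" k, OF _ le, folded root_series_eq[of k]]
  show "root_coeff p n \<le> schroeder_fps k $$ n"
    using coeffs_nonnegD[OF *(1), of n] by simp
  show "schroeder_fps k $$ n = root_coeff p n" if "n < (m + 1) ^ k"
    using fps_X_power_dvdD[OF *(2) that] by simp
qed

text \<open>The iterates decrease coefficientwise in \<open>k\<close>, starting from the constant
  series \<open>1\<close>.\<close>

lemma schroeder_fps_nth_nonpos:
  assumes "0 < n"
  shows "schroeder_fps k $$ n \<le> 0"
proof (induction k)
  case 0
  then show ?case using assms by simp
next
  case (Suc k)
  have "T $$ n \<le> 0" if "0 < n" for n
    using root_coeff_neg[OF p_ge_2 that] by simp
  then have "coeffs_nonneg (schroeder_fps k - schroeder_fps (Suc k))"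
    unfolding schroeder_fps_Suc by (intro schroeder_fps_minus_schroeder_fps_mult_compose) auto
  then have "schroeder_fps (Suc k) $$ n \<le> schroeder_fps k $$ n"
    using coeffs_nonnegD[of _ n] by fastforce
  then show ?case using Suc by simp
qed

lemma abs_schroeder_fps_nth_le_1: "\<bar>schroeder_fps k $$ n\<bar> \<le> 1"
proof (cases "n = 0")
  case False
  then show ?thesis
    using sum_neg_root_coeff_le_1[OF p_ge_2, of "{n}"] schroeder_fps_nth_nonpos[of n k]
      root_coeff_le_schroeder_fps_nth[of n k] by simp
qed simp

text \<open>\<open>residual_fps k\<close> has nonnegative coefficients, so those of \<open>inverse (schroeder_fps k) ^ p\<close> decrease from \<open>1\<close>.\<close>

lemma inverse_schroeder_fps_power_nth_le_1: "inverse (schroeder_fps k) ^ p $$ n \<le> 1"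
proof (induction n)
  case (Suc n)
  have "0 \<le> residual_fps k $$ Suc n" by (rule coeffs_nonnegD[OF coeffs_nonneg_residual_fps])
  then show ?case
    using Suc unfolding residual_fps_def by (simp add: one_minus_fps_X_mult_nth)
qed (simp add: fps_nth_power_0)

lemma abs_inverse_schroeder_fps_power_nth_le_1: "\<bar>inverse (schroeder_fps k) ^ p $$ n\<bar> \<le> 1"
proof -
  have "coeffs_nonneg (inverse (schroeder_fps k) ^ p)"
    by (intro coeffs_nonneg_power coeffs_nonneg_inverse schroeder_fps_nth_nonpos) auto
  then show ?thesis
    using inverse_schroeder_fps_power_nth_le_1[of k n] by (simp add: coeffs_nonnegD)
qed

end

section \<open>Common eigenvectors and uniqueness of the principal root\<close>

text \<open>Horner's scheme for the vector \<open>q(X) v\<close>. Only the action on a single vector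
  is needed, so the matrix \<open>q(X)\<close> is never formed.\<close>

definition poly_apply :: "complex ^ 'n ^ 'n \<Rightarrow> complex poly \<Rightarrow> complex ^ 'n \<Rightarrow> complex ^ 'n" where
  "poly_apply X q v = fold_coeffs (\<lambda>a w. a *s v + X *v w) q 0"

lemma poly_apply_0 [simp]: "poly_apply X 0 v = 0"
  by (simp add: poly_apply_def)

lemma poly_apply_pCons [simp]: "poly_apply X (pCons a q) v = a *s v + X *v poly_apply X q v"
  by (cases "a = 0"; cases "q = 0") (simp_all add: poly_apply_def)

lemma matrix_vector_mult_vector_scalar:
  "X *v (c *s v) = c *s (X *v (v :: 'a::comm_semiring_1 ^ 'n))"
  by (simp add: vec_eq_iff matrix_vector_mult_def sum_distrib_left mult_ac)

lemma poly_apply_add: "poly_apply X (q + q') v = poly_apply X q v + poly_apply X q' v"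
proof (induction q q' rule: poly_induct2)
  case (pCons a q b q')
  then show ?case
    by (simp add: matrix_vector_right_distrib vector_sadd_rdistrib)
qed simp

lemma poly_apply_smult: "poly_apply X (smult c q) v = c *s poly_apply X q v"
  by (induction q) (simp_all add: matrix_vector_mult_vector_scalar vector_add_ldistrib vector_smult_assoc)

lemma poly_apply_sum: "poly_apply X (\<Sum>i\<in>S. f i) v = (\<Sum>i\<in>S. poly_apply X (f i) v)"
  by (induction S rule: infinite_finite_induct) (simp_all add: poly_apply_add)

lemma poly_apply_monom: "poly_apply X (monom c n) v = c *s (matrix_pow X n *v v)"
  by (induction n) (simp_all add: monom_0 monom_Suc matrix_vector_mult_vector_scalar matrix_vector_mul_assoc[symmetric])

lemma poly_apply_linear_factor:
  "poly_apply X ([:- a, 1:] * q) v = X *v poly_apply X q v - a *s poly_apply X q v"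
proof -
  have "[:- a, 1:] * q = smult (- a) q + pCons 0 q" by simp
  then show ?thesis by (simp only: poly_apply_add poly_apply_smult poly_apply_pCons) (simp add: vec_eq_iff)
qed

text \<open>The vectors \<open>X ^ i v\<close> for \<open>i \<le> d\<close> outnumber the dimension
  \<open>d\<close>; the coefficients of a linear relation among them form the polynomial.\<close>

lemma annihilating_poly_exists:
  fixes X :: "complex ^ 'n ^ 'n"
  shows "\<exists>q. q \<noteq> 0 \<and> poly_apply X q v = 0"
proof -
  define w where "w i = matrix_pow X i *v v" for i
  define d where "d = vec.dim (UNIV :: (complex ^ 'n) set)"
  show ?thesis
  \<comment> \<open>Dependence is a property of the set of vectors, so a repetition among them is
    treated apart, by a difference of two monomials.\<close>
  proof (cases "inj_on w {..d}")
    case True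
    have "vec.dependent (w ` {..d})"
    proof (rule vec.dependent_biggerset_general)
      show "vec.dim (w ` {..d}) < card (w ` {..d})"
        using vec.dim_subset_UNIV[of "w ` {..d}"] True
        by (simp add: card_image d_def vec.dimension_def)
    qed
    then obtain u i where u: "(\<Sum>x\<in>w ` {..d}. u x *s x) = 0" "i \<le> d" "u (w i) \<noteq> 0"
      using vec.dependent_finite[of "w ` {..d}"] by auto
    define q where "q = (\<Sum>i\<le>d. monom (u (w i)) i)"
    have "coeff q i = u (w i)"
      using u(2) by (simp add: q_def coeff_sum)
    then have "q \<noteq> 0" using u(3) by auto
    moreover have "poly_apply X q v = 0"
      using u(1) unfolding sum.reindex[OF True]
      by (simp add: q_def poly_apply_sum poly_apply_monom w_def)
    ultimately show ?thesis by blast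
  next
    case False
    then obtain i j where ij: "i \<noteq> j" "w i = w j" by (auto simp: inj_on_def)
    define q where "q = monom 1 i + monom (- 1 :: complex) j"
    have "coeff q i = 1" using ij by (simp add: q_def)
    then have "q \<noteq> 0" by auto
    moreover have "poly_apply X q v = 0"
      using ij(2) by (simp add: q_def poly_apply_add poly_apply_monom w_def)
    ultimately show ?thesis by blast
  qed
qed

text \<open>An annihilating polynomial \<open>q\<close> of \<open>v\<close> of least degree has a
  root \<open>a\<close>. Splitting off its linear factor leaves \<open>q'\<close> with
  \<open>q'(X) v\<close> nonzero by minimality, in \<open>S\<close> by invariance, and an
  eigenvector for \<open>a\<close>.\<close>

lemma invariant_subspace_eigenvector:
  fixes X :: "complex ^ 'n ^ 'n"
  assumes S: "vec.subspace S" and inv: "\<And>w. w \<in> S \<Longrightarrow> X *v w \<in> S"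
    and v: "v \<in> S" "v \<noteq> 0"
  obtains w a where "w \<in> S" "w \<noteq> 0" "X *v w = a *s w"
proof -
  define P where "P q \<longleftrightarrow> q \<noteq> 0 \<and> poly_apply X q v = 0" for q
  have "\<exists>q. P q" using annihilating_poly_exists[of X v] by (simp add: P_def)
  then obtain q where q: "P q" and least: "\<And>q'. P q' \<Longrightarrow> degree q \<le> degree q'"
    using ex_has_least_nat[of P _ degree] by blast
  have "degree q \<noteq> 0"
  proof
    assume "degree q = 0"
    then obtain c where "q = [:c:]" by (rule degree_eq_zeroE)
    then show False using q v(2) by (auto simp: P_def)
  qed
  then obtain a where "poly q a = 0"
    using fundamental_theorem_of_algebra[of q] constant_degree[of q] by auto
  then obtain q' where q': "q = [:- a, 1:] * q'" by (auto simp: poly_eq_0_iff_dvd)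
  have "q' \<noteq> 0" using q q' by (auto simp: P_def)
  then have "degree q = Suc (degree q')" 
    using q' degree_mult_eq[of "[:- a, 1:]" q'] by (simp del: mult_pCons_left)
  then have "\<not> P q'" using least[of q'] by auto
  then have "poly_apply X q' v \<noteq> 0" using \<open>q' \<noteq> 0\<close> by (simp add: P_def)
  moreover have "poly_apply X q' v \<in> S"
    by (induction q') (auto intro: vec.subspace_add[OF S] vec.subspace_scale[OF S] vec.subspace_0[OF S] inv v)
  moreover have "X *v poly_apply X q' v = a *s poly_apply X q' v"
    using q unfolding P_def q' poly_apply_linear_factor by simp
  ultimately show thesis using that by blast
qed

text \<open>By commutation \<open>Y\<close> preserves the eigenspace of \<open>X\<close> within
  \<open>S\<close>, so an eigenvector of \<open>Y\<close> can be found inside it.\<close>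

lemma common_eigenvector:
  fixes X Y :: "complex ^ 'n ^ 'n"
  assumes S: "vec.subspace S" "\<And>w. w \<in> S \<Longrightarrow> X *v w \<in> S" "\<And>w. w \<in> S \<Longrightarrow> Y *v w \<in> S"
    and XY: "X ** Y = Y ** X" and v: "v \<in> S" "v \<noteq> 0"
  obtains w a b where "w \<in> S" "w \<noteq> 0" "X *v w = a *s w" "Y *v w = b *s w"
proof -
  obtain w1 a where w1: "w1 \<in> S" "w1 \<noteq> 0" "X *v w1 = a *s w1"
    using invariant_subspace_eigenvector[of S X v] S v by metis
  define S' where "S' = S \<inter> {w. X *v w = a *s w}"
  have "vec.subspace {w. X *v w = a *s w}"
    by (auto simp: vec.subspace_def matrix_vector_right_distrib matrix_vector_mult_vector_scalar
        vector_add_ldistrib vector_smult_assoc mult.commute)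
  then have "vec.subspace S'"
    unfolding S'_def by (rule vec.subspace_inter[OF S(1)])
  moreover have "Y *v w \<in> S'" if "w \<in> S'" for w
  proof -
    have "X *v (Y *v w) = Y *v (X *v w)" by (simp add: matrix_vector_mul_assoc XY)
    then show ?thesis
      using that S(3) by (auto simp: S'_def matrix_vector_mult_vector_scalar)
  qed
  ultimately obtain w b where "w \<in> S'" "w \<noteq> 0" "Y *v w = b *s w"
    using invariant_subspace_eigenvector[of S' Y w1] w1 by (auto simp: S'_def)
  then show thesis using that by (auto simp: S'_def)
qed

lemma matrix_pow_commute:
  assumes "X ** Y = Y ** X"
  shows "matrix_pow X n ** Y = Y ** matrix_pow X n"
proof (induction n)
  case (Suc n)
  have "matrix_pow X (Suc n) ** Y = X ** (Y ** matrix_pow X n)"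
    by (simp add: matrix_mul_assoc[symmetric] Suc)
  also have "\<dots> = Y ** matrix_pow X (Suc n)"
    by (simp add: matrix_mul_assoc assms)
  finally show ?case .
qed simp

lemma matrix_pow_eigenvector:
  fixes X :: "complex ^ 'n ^ 'n"
  assumes "X *v w = a *s w"
  shows "matrix_pow X n *v w = a ^ n *s w"
  by (induction n)
    (simp_all add: matrix_vector_mul_assoc[symmetric] matrix_vector_mult_vector_scalar assms vector_smult_assoc mult.commute)

section \<open>The sum of all \<open>X ^ i Y ^ (n - 1 - i)\<close>, cofactor of \<open>X - Y\<close>
  in \<open>X ^ n - Y ^ n\<close>\<close>

primrec pow_diff_cofactor :: "complex ^ 'n ^ 'n \<Rightarrow> complex ^ 'n ^ 'n \<Rightarrow> nat \<Rightarrow> complex ^ 'n ^ 'n" where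
  "pow_diff_cofactor X Y 0 = 0"
| "pow_diff_cofactor X Y (Suc n) = X ** pow_diff_cofactor X Y n + matrix_pow Y n"

lemma matrix_add_rdistrib: "(Y + Z) ** X = Y ** X + Z ** (X :: complex ^ 'n ^ 'n)"
  by (simp add: vec_eq_iff matrix_matrix_mult_def sum.distrib algebra_simps)

lemma matrix_mult_diff_distrib:
  fixes X Y Z :: "complex ^ 'n ^ 'n"
  shows "X ** (Y - Z) = X ** Y - X ** Z" and "(Y - Z) ** X = Y ** X - Z ** X"
  by (simp_all add: vec_eq_iff matrix_matrix_mult_def sum_subtractf algebra_simps)

lemma pow_diff_cofactor_mult:
  assumes "X ** Y = Y ** X"
  shows "pow_diff_cofactor X Y n ** (X - Y) = matrix_pow X n - matrix_pow Y n"
proof (induction n)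
  case 0
  then show ?case by (simp add: vec_eq_iff matrix_matrix_mult_def)
next
  case (Suc n)
  have "matrix_pow Y n ** X = X ** matrix_pow Y n"
    using matrix_pow_commute[of Y X n] assms by simp
  moreover have "matrix_pow Y n ** Y = Y ** matrix_pow Y n"
    by (rule matrix_pow_commute) simp
  ultimately have "pow_diff_cofactor X Y (Suc n) ** (X - Y)
      = X ** (pow_diff_cofactor X Y n ** (X - Y)) + (X ** matrix_pow Y n - Y ** matrix_pow Y n)"
    by (simp add: matrix_add_rdistrib matrix_mult_diff_distrib(1)[of "matrix_pow Y n"] flip: matrix_mul_assoc)
  also have "\<dots> = matrix_pow X (Suc n) - matrix_pow Y (Suc n)"
    unfolding Suc by (simp add: matrix_mult_diff_distrib(1))
  finally show ?case .
qed

lemma pow_diff_cofactor_commute: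
  assumes "X ** Z = Z ** X" "Y ** Z = Z ** Y"
  shows "pow_diff_cofactor X Y n ** Z = Z ** pow_diff_cofactor X Y n"
proof (induction n)
  case 0
  then show ?case by (simp add: vec_eq_iff matrix_matrix_mult_def)
next
  case (Suc n)
  have "X ** pow_diff_cofactor X Y n ** Z = Z ** (X ** pow_diff_cofactor X Y n)"
    by (metis Suc assms(1) matrix_mul_assoc)
  then show ?case
    using matrix_pow_commute[OF assms(2)] by (simp add: matrix_add_rdistrib matrix_add_ldistrib)
qed

text \<open>The equation for \<open>s * (x - y)\<close> does not determine \<open>s\<close> when
  \<open>x = y\<close>; the last clause supplies the value there.\<close>

lemma pow_diff_cofactor_eigenvector:
  fixes X Y :: "complex ^ 'n ^ 'n"
  assumes "X *v w = x *s w" "Y *v w = y *s w"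
  shows "\<exists>s. pow_diff_cofactor X Y n *v w = s *s w \<and> s * (x - y) = x ^ n - y ^ n
             \<and> (x = y \<longrightarrow> s = of_nat n * x ^ (n - 1))"
proof (induction n)
  case 0
  then show ?case by (intro exI[of _ 0]) simp
next
  case (Suc n)
  then obtain s where s: "pow_diff_cofactor X Y n *v w = s *s w" "s * (x - y) = x ^ n - y ^ n"
    "x = y \<Longrightarrow> s = of_nat n * x ^ (n - 1)" by blast
  have "pow_diff_cofactor X Y (Suc n) *v w = (x * s + y ^ n) *s w"
    by (simp add: matrix_vector_mult_add_rdistrib matrix_vector_mul_assoc[symmetric] s(1)
        matrix_vector_mult_vector_scalar assms matrix_pow_eigenvector vector_sadd_rdistrib vector_smult_assoc mult.commute)
  moreover have "(x * s + y ^ n) * (x - y) = x * (s * (x - y)) + y ^ n * (x - y)"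
    by (simp add: algebra_simps)
  then have "(x * s + y ^ n) * (x - y) = x ^ Suc n - y ^ Suc n"
    unfolding s(2) by (simp add: algebra_simps)
  moreover have "x * s + y ^ n = of_nat (Suc n) * x ^ (Suc n - 1)" if "x = y"
    using s(3)[OF that] that by (cases n) (simp_all add: algebra_simps)
  ultimately show ?case by blast
qed

text \<open>In the sector \<open>p * Ln z\<close> has imaginary part of modulus below
  \<open>pi\<close>, so \<open>Ln (z ^ p) = p * Ln z\<close> and \<open>z ^ p\<close> determines
  \<open>Ln z\<close>.\<close>

lemma sector_root_unique:
  fixes x y :: complex
  assumes "x ^ p = y ^ p" "0 < p" "x \<noteq> 0" "y \<noteq> 0" "\<bar>Arg x\<bar> < pi / real p" "\<bar>Arg y\<bar> < pi / real p"
  shows "x = y"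
proof -
  have Ln_power: "Ln (z ^ p) = of_nat p * Ln z" if "z \<noteq> 0" "\<bar>Arg z\<bar> < pi / real p" for z
  proof -
    have "\<bar>real p * Arg z\<bar> < pi"
      using that(2) \<open>0 < p\<close> by (simp add: abs_mult field_simps)
    then have "Ln (exp (of_nat p * Ln z)) = of_nat p * Ln z"
      using that(1) by (intro Ln_exp) (auto simp: Arg_eq_Im_Ln)
    then show ?thesis using that(1) by (simp add: exp_of_nat_mult)
  qed
  have "Ln x = Ln y" using Ln_power[of x] Ln_power[of y] assms by simp
  then show ?thesis using assms(3,4) by (metis exp_Ln)
qed

text \<open>If \<open>X\<close> and \<open>Y\<close> differ, the kernel of their cofactor contains
  the nonzero range of \<open>X - Y\<close>, hence a common eigenvector. The cofactor has eigenvalue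
  \<open>0\<close> on it, so \<open>x ^ p = y ^ p\<close> and \<open>x = y\<close>; but then that
  eigenvalue is \<open>p x ^ (p - 1)\<close>, which is nonzero.\<close>

lemma commuting_principal_roots_eq:
  assumes X: "is_principal_root p A X" and Y: "is_principal_root p A Y"
    and XY: "X ** Y = Y ** X" and p: "0 < p"
  shows "X = Y"
proof (rule ccontr)
  assume "X \<noteq> Y"
  define C where "C = pow_diff_cofactor X Y p"
  have C0: "C ** (X - Y) = 0"
    using X Y by (simp add: C_def pow_diff_cofactor_mult[OF XY] is_principal_root_def)
  obtain u where u: "(X - Y) *v u \<noteq> 0"
    using \<open>X \<noteq> Y\<close> matrix_eq[of "X - Y" 0] by auto
  define S where "S = {v. C *v v = 0}"
  have S: "vec.subspace S"
    by (auto simp: S_def vec.subspace_def matrix_vector_right_distrib matrix_vector_mult_vector_scalar)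
  have inv: "Z *v w \<in> S" if "C ** Z = Z ** C" "w \<in> S" for Z w
  proof -
    have "C *v (Z *v w) = Z *v (C *v w)" by (simp add: matrix_vector_mul_assoc that(1))
    then show ?thesis using that(2) by (simp add: S_def)
  qed
  have CX: "C ** X = X ** C" and CY: "C ** Y = Y ** C"
    unfolding C_def by (rule pow_diff_cofactor_commute; simp add: XY)+
  have "(X - Y) *v u \<in> S"
    by (simp add: S_def matrix_vector_mul_assoc C0)
  then obtain w x y where w: "w \<in> S" "w \<noteq> 0" "X *v w = x *s w" "Y *v w = y *s w"
    using common_eigenvector[OF S inv[OF CX] inv[OF CY] XY _ u] by blast
  obtain s where s: "C *v w = s *s w" "s * (x - y) = x ^ p - y ^ p"
     "x = y \<Longrightarrow> s = of_nat p * x ^ (p - 1)"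
    using pow_diff_cofactor_eigenvector[OF w(3,4)] unfolding C_def by blast
  have "s = 0" using s(1) w(1,2) by (simp add: S_def)
  have xy: "x \<noteq> 0" "\<bar>Arg x\<bar> < pi / real p" "y \<noteq> 0" "\<bar>Arg y\<bar> < pi / real p"
    using X Y w(2-4) unfolding is_principal_root_def eigenvalue_def by blast+
  have "x = y"
    using s(2) \<open>s = 0\<close> by (intro sector_root_unique[OF _ p xy(1,3,2,4)]) simp
  then show False using s(3) \<open>s = 0\<close> xy(1) p by simp
qed

section \<open>Evaluating power series at a matrix\<close>

definition matrix_unit :: "'n \<Rightarrow> 'n \<Rightarrow> complex ^ 'n ^ 'n" where
  "matrix_unit i j = (\<chi> a b. if a = i \<and> b = j then 1 else 0)"

lemma matrix_unit_sandwich: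
  "matrix_unit i i ** M ** matrix_unit j j = matrix_cscale (M $ i $ j) (matrix_unit i j)"
proof -
  have "(matrix_unit i i ** M) $ a $ b = (if a = i then M $ i $ b else 0)" for a b
    by (simp add: matrix_matrix_mult_def matrix_unit_def if_distrib[of "\<lambda>x. x * _"] cong: if_cong)
  then show ?thesis
    unfolding vec_eq_iff matrix_cscale_def
    by (auto simp: matrix_matrix_mult_def[of "_ ** _"] matrix_unit_def if_distrib[of "\<lambda>x. _ * x"] cong: if_cong)
qed

lemma matrix_eq_sum_matrix_units:
  "M = (\<Sum>i\<in>UNIV. \<Sum>j\<in>UNIV. matrix_cscale (M $ i $ j) (matrix_unit i j))"
proof -
  have "(\<Sum>i\<in>UNIV. \<Sum>j\<in>UNIV. matrix_cscale (M $ i $ j) (matrix_unit i j)) $ a $ b = M $ a $ b" for a b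
  proof -
    have "(\<Sum>i\<in>UNIV. \<Sum>j\<in>UNIV. matrix_cscale (M $ i $ j) (matrix_unit i j)) $ a $ b
        = (\<Sum>i\<in>UNIV. \<Sum>j\<in>UNIV. if i = a then if j = b then M $ i $ j else 0 else 0)"
      by (simp add: matrix_cscale_def matrix_unit_def) (intro sum.cong refl; auto)
    also have "\<dots> = (\<Sum>i\<in>UNIV. if i = a then M $ i $ b else 0)"
      by (intro sum.cong refl) auto
    finally show ?thesis by simp
  qed
  then show ?thesis by (simp add: vec_eq_iff)
qed

lemma scaleR_eq_matrix_cscale: "c *\<^sub>R M = matrix_cscale (of_real c) M"
  unfolding vec_eq_iff matrix_cscale_def vector_scaleR_component by (simp add: scaleR_conv_of_real[where 'a = complex])

lemma matrix_inv_eqI: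
  fixes X Y :: "complex ^ 'n ^ 'n"
  assumes "X ** Y = mat 1" "Y ** X = mat 1"
  shows "matrix_inv X = Y"
proof -
  let ?Z = "matrix_inv X"
  have "X ** ?Z = mat 1 \<and> ?Z ** X = mat 1"
    unfolding matrix_inv_def by (rule someI[of _ Y]) (use assms in simp)
  then show ?thesis by (metis assms(1) matrix_mul_assoc matrix_mul_lid matrix_mul_rid)
qed

section \<open>Submultiplicative norms and matrix entries\<close>

locale normed_matrix =
  fixes N :: "complex ^ 'n ^ 'n \<Rightarrow> real" and B :: "complex ^ 'n ^ 'n"
  assumes matrix_norm: "matrix_norm N" and norm_B: "N B < 1"
begin

lemma norm_nonneg: "0 \<le> N M"
  and norm_eq_0: "N M = 0 \<longleftrightarrow> M = 0"
  and norm_cscale: "N (matrix_cscale c M) = cmod c * N M"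
  and norm_triangle: "N (M + M') \<le> N M + N M'"
  and norm_mult: "N (M ** M') \<le> N M * N M'"
  using matrix_norm by (simp_all add: matrix_norm_def)

lemma norm_0 [simp]: "N 0 = 0"
  by (simp add: norm_eq_0)

lemma norm_sum: "N (\<Sum>i\<in>S. f i) \<le> (\<Sum>i\<in>S. N (f i))"
proof (induction S rule: infinite_finite_induct)
  case (insert x S)
  then show ?case using norm_triangle[of "f x" "\<Sum>i\<in>S. f i"] by simp
qed simp_all

lemma norm_scaleR: "N (c *\<^sub>R M) = \<bar>c\<bar> * N M"
  by (simp add: scaleR_eq_matrix_cscale norm_cscale)

text \<open>Turns entrywise convergence into convergence with respect to \<open>N\<close>.\<close>

lemma norm_le_sum_entries: "N M \<le> (\<Sum>i\<in>UNIV. \<Sum>j\<in>UNIV. cmod (M $ i $ j) * N (matrix_unit i j))"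
proof -
  have "N M = N (\<Sum>i\<in>UNIV. \<Sum>j\<in>UNIV. matrix_cscale (M $ i $ j) (matrix_unit i j))"
    using matrix_eq_sum_matrix_units[of M] by simp
  also have "\<dots> \<le> (\<Sum>i\<in>UNIV. \<Sum>j\<in>UNIV. N (matrix_cscale (M $ i $ j) (matrix_unit i j)))"
    by (intro order.trans[OF norm_sum] sum_mono order.refl)
  finally show ?thesis by (simp add: norm_cscale)
qed

text \<open>Sandwiching \<open>M\<close> between matrix units isolates an entry, so submultiplicativity
  bounds the entries without an appeal to compactness.\<close>

lemma entry_le_norm: "\<exists>C\<ge>0. \<forall>M. cmod (M $ i $ j) \<le> C * N M"
proof -
  let ?E = "matrix_unit :: 'n \<Rightarrow> 'n \<Rightarrow> complex ^ 'n ^ 'n"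
  have "?E i j $ i $ j \<noteq> 0" by (simp add: matrix_unit_def)
  then have "N (?E i j) \<noteq> 0" unfolding norm_eq_0 by auto
  then have pos: "0 < N (?E i j)" using norm_nonneg[of "?E i j"] by simp
  have "cmod (M $ i $ j) \<le> N (?E i i) * N (?E j j) / N (?E i j) * N M" for M
  proof -
    have "cmod (M $ i $ j) * N (?E i j) = N (?E i i ** M ** ?E j j)"
      by (simp add: matrix_unit_sandwich norm_cscale)
    also have "\<dots> \<le> N (?E i i) * N M * N (?E j j)"
      by (intro order.trans[OF norm_mult] mult_right_mono norm_mult norm_nonneg)
    finally show ?thesis using pos by (simp add: field_simps)
  qed
  then show ?thesis
    using norm_nonneg by (intro exI[of _ "N (?E i i) * N (?E j j) / N (?E i j)"]) auto
qed

lemma norm_matrix_pow: "N (matrix_pow M n) \<le> N (mat 1) * N M ^ n"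
proof (induction n)
  case (Suc n)
  have "N (matrix_pow M (Suc n)) \<le> N M * N (matrix_pow M n)" by (simp add: norm_mult)
  also have "\<dots> \<le> N M * (N (mat 1) * N M ^ n)" by (intro mult_left_mono Suc norm_nonneg)
  finally show ?case by (simp add: mult_ac)
qed simp

text \<open>The unit matrix may have norm greater than \<open>1\<close>, hence the restriction \<open>0 < n\<close>.\<close>

lemma norm_matrix_pow_pos: "0 < n \<Longrightarrow> N (matrix_pow M n) \<le> N M ^ n"
proof (induction n rule: nat_induct_non_zero)
  case (Suc n)
  have "N (matrix_pow M (Suc n)) \<le> N M * N (matrix_pow M n)" by (simp add: norm_mult)
  also have "\<dots> \<le> N M * N M ^ n" by (intro mult_left_mono Suc norm_nonneg)
  finally show ?case by simp
qed simp

definition abs_convergent :: "real fps \<Rightarrow> bool" where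
  "abs_convergent F \<longleftrightarrow> summable (\<lambda>n. \<bar>F $$ n\<bar> * N B ^ n)"

text \<open>Taken entrywise, the sum is a limit of complex numbers and does not refer to
  \<open>N\<close>; the norm enters through \<open>abs_convergent\<close>.\<close>

definition fps_eval :: "real fps \<Rightarrow> complex ^ 'n ^ 'n" where
  "fps_eval F = (\<chi> i j. \<Sum>n. of_real (F $$ n) * matrix_pow B n $ i $ j)"

lemma abs_convergent_bounded: "(\<And>n. \<bar>F $$ n\<bar> \<le> 1) \<Longrightarrow> abs_convergent F"
  unfolding abs_convergent_def
proof (rule summable_comparison_test')
  show "summable (\<lambda>n. N B ^ n)" using norm_nonneg norm_B by (simp add: summable_geometric)
  show "norm (\<bar>F $$ n\<bar> * N B ^ n) \<le> N B ^ n" if "\<And>n. \<bar>F $$ n\<bar> \<le> 1" for n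
    using mult_right_mono[OF that[of n], of "N B ^ n"] by (simp add: abs_mult norm_nonneg)
qed

lemma abs_convergent_1 [simp]: "abs_convergent 1" and abs_convergent_fps_X [simp]: "abs_convergent fps_X"
  by (auto intro!: abs_convergent_bounded simp: fps_X_def fps_one_nth)

lemma abs_convergent_diff: "abs_convergent F \<Longrightarrow> abs_convergent G \<Longrightarrow> abs_convergent (F - G)"
  unfolding abs_convergent_def
proof (rule summable_comparison_test'[of "\<lambda>n. \<bar>F $$ n\<bar> * N B ^ n + \<bar>G $$ n\<bar> * N B ^ n"])
  fix n
  show "norm (\<bar>(F - G) $$ n\<bar> * N B ^ n) \<le> \<bar>F $$ n\<bar> * N B ^ n + \<bar>G $$ n\<bar> * N B ^ n"
    using mult_right_mono[OF abs_triangle_ineq4[of "F $$ n" "G $$ n"], of "N B ^ n"]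
    by (simp add: abs_mult norm_nonneg distrib_right)
qed (rule summable_add)

lemma abs_convergent_mult: "abs_convergent F \<Longrightarrow> abs_convergent G \<Longrightarrow> abs_convergent (F * G)"
  unfolding abs_convergent_def
proof (rule summable_comparison_test')
  assume "summable (\<lambda>n. \<bar>F $$ n\<bar> * N B ^ n)" "summable (\<lambda>n. \<bar>G $$ n\<bar> * N B ^ n)"
  then show "summable (\<lambda>n. \<Sum>i\<le>n. (\<bar>F $$ i\<bar> * N B ^ i) * (\<bar>G $$ (n - i)\<bar> * N B ^ (n - i)))"
    by (intro summable_Cauchy_product) (simp_all add: abs_mult norm_nonneg)
  fix n
  have "\<bar>(F * G) $$ n\<bar> * N B ^ n \<le> (\<Sum>i=0..n. \<bar>F $$ i * G $$ (n - i)\<bar>) * N B ^ n"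
    unfolding fps_mult_nth by (intro mult_right_mono sum_abs) (simp add: norm_nonneg)
  also have "\<dots> = (\<Sum>i=0..n. (\<bar>F $$ i\<bar> * N B ^ i) * (\<bar>G $$ (n - i)\<bar> * N B ^ (n - i)))"
    unfolding sum_distrib_right
  proof (rule sum.cong[OF refl])
    fix i
    assume "i \<in> {0..n}"
    then have "N B ^ n = N B ^ i * N B ^ (n - i)" by (simp flip: power_add)
    then show "\<bar>F $$ i * G $$ (n - i)\<bar> * N B ^ n = (\<bar>F $$ i\<bar> * N B ^ i) * (\<bar>G $$ (n - i)\<bar> * N B ^ (n - i))"
      by (simp add: abs_mult mult_ac)
  qed
  finally show "norm (\<bar>(F * G) $$ n\<bar> * N B ^ n)
      \<le> (\<Sum>i\<le>n. (\<bar>F $$ i\<bar> * N B ^ i) * (\<bar>G $$ (n - i)\<bar> * N B ^ (n - i)))"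
    by (simp add: abs_mult norm_nonneg atMost_atLeast0)
qed

lemma abs_convergent_power: "abs_convergent F \<Longrightarrow> abs_convergent (F ^ k)"
  by (induction k) (simp_all add: abs_convergent_mult)

lemma summable_entry:
  assumes "abs_convergent F"
  shows "summable (\<lambda>n. norm (of_real (F $$ n) * matrix_pow B n $ i $ j))"
proof -
  obtain C where C: "C \<ge> 0" "\<And>M. cmod (M $ i $ j) \<le> C * N M"
    using entry_le_norm[of i j] by blast
  show ?thesis
  proof (rule summable_comparison_test')
    show "summable (\<lambda>n. C * N (mat 1) * (\<bar>F $$ n\<bar> * N B ^ n))"
      using assms unfolding abs_convergent_def by (rule summable_mult)
    fix n
    have "cmod (matrix_pow B n $ i $ j) \<le> C * (N (mat 1) * N B ^ n)"
      by (rule order.trans[OF C(2)]) (intro mult_left_mono norm_matrix_pow C(1))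
    then have "\<bar>F $$ n\<bar> * cmod (matrix_pow B n $ i $ j) \<le> \<bar>F $$ n\<bar> * (C * (N (mat 1) * N B ^ n))"
      by (rule mult_left_mono) simp
    then show "norm (norm (of_real (F $$ n) * matrix_pow B n $ i $ j)) \<le> C * N (mat 1) * (\<bar>F $$ n\<bar> * N B ^ n)"
      by (simp add: Real_Vector_Spaces.norm_mult mult_ac)
  qed
qed

lemma fps_eval_sums:
  assumes "abs_convergent F"
  shows "(\<lambda>n. of_real (F $$ n) * matrix_pow B n $ i $ j) sums (fps_eval F $ i $ j)"
  using summable_sums[OF summable_norm_cancel[OF summable_entry[OF assms]]] by (simp add: fps_eval_def)

lemma fps_eval_eqI:
  assumes "abs_convergent F" "\<And>i j. (\<lambda>n. of_real (F $$ n) * matrix_pow B n $ i $ j) sums (M $ i $ j)"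
  shows "fps_eval F = M"
  using sums_unique2[OF fps_eval_sums[OF assms(1)] assms(2)] by (simp add: vec_eq_iff)

lemma fps_eval_1 [simp]: "fps_eval 1 = mat 1"
proof (rule fps_eval_eqI)
  fix i j
  have "(\<lambda>n. of_real ((1 :: real fps) $$ n) * matrix_pow B n $ i $ j) = (\<lambda>n. if n = 0 then mat 1 $ i $ j else 0)"
    by auto
  then show "(\<lambda>n. of_real ((1 :: real fps) $$ n) * matrix_pow B n $ i $ j) sums (mat 1 $ i $ j)"
    using sums_single[of 0 "\<lambda>_. mat 1 $ i $ j :: complex"] by (simp only:)
qed simp

lemma fps_eval_fps_X [simp]: "fps_eval fps_X = B"
proof (rule fps_eval_eqI)
  fix i j
  have "(\<lambda>n. of_real ((fps_X :: real fps) $$ n) * matrix_pow B n $ i $ j) = (\<lambda>n. if n = 1 then B $ i $ j else 0)"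
    by (auto simp: fps_X_def)
  then show "(\<lambda>n. of_real ((fps_X :: real fps) $$ n) * matrix_pow B n $ i $ j) sums (B $ i $ j)"
    using sums_single[of 1 "\<lambda>_. B $ i $ j"] by (simp only:)
qed simp

lemma fps_eval_diff: "abs_convergent F \<Longrightarrow> abs_convergent G \<Longrightarrow> fps_eval (F - G) = fps_eval F - fps_eval G"
  by (intro fps_eval_eqI abs_convergent_diff) (auto simp: left_diff_distrib intro!: sums_diff fps_eval_sums)

lemma matrix_pow_add: "matrix_pow M (a + b) = matrix_pow M a ** matrix_pow M b"
  by (induction a) (simp_all add: matrix_mul_assoc)

text \<open>An entry of the product is a finite sum over \<open>l\<close> of Cauchy products of
  entry series; summing over \<open>l\<close> first reassembles
  \<open>B ^ k B ^ (n - k) = B ^ n\<close>.\<close>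

lemma fps_eval_mult:
  assumes "abs_convergent F" "abs_convergent G"
  shows "fps_eval (F * G) = fps_eval F ** fps_eval G"
proof (rule fps_eval_eqI)
  show "abs_convergent (F * G)" using assms by (rule abs_convergent_mult)
  fix i j
  let ?f = "\<lambda>l n. of_real (F $$ n) * matrix_pow B n $ i $ l"
  let ?g = "\<lambda>l n. of_real (G $$ n) * matrix_pow B n $ l $ j"
  have "(\<lambda>n. \<Sum>k\<le>n. ?f l k * ?g l (n - k)) sums (fps_eval F $ i $ l * fps_eval G $ l $ j)" for l
    using Cauchy_product_sums[OF summable_entry[OF assms(1)] summable_entry[OF assms(2)], of i l l j]
    by (simp add: fps_eval_def)
  then have "(\<lambda>n. \<Sum>l\<in>UNIV. \<Sum>k\<le>n. ?f l k * ?g l (n - k)) sums (\<Sum>l\<in>UNIV. fps_eval F $ i $ l * fps_eval G $ l $ j)"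
    by (intro sums_sum)
  moreover have "(\<Sum>l\<in>UNIV. \<Sum>k\<le>n. ?f l k * ?g l (n - k)) = of_real ((F * G) $$ n) * matrix_pow B n $ i $ j" for n
  proof -
    have "(\<Sum>l\<in>UNIV. \<Sum>k\<le>n. ?f l k * ?g l (n - k)) = (\<Sum>k\<le>n. \<Sum>l\<in>UNIV. ?f l k * ?g l (n - k))"
      by (rule sum.swap)
    also have "\<dots> = (\<Sum>k\<le>n. of_real (F $$ k * G $$ (n - k)) * matrix_pow B n $ i $ j)"
    proof (rule sum.cong[OF refl])
      fix k
      assume "k \<in> {..n}"
      then have "matrix_pow B n = matrix_pow B k ** matrix_pow B (n - k)" by (simp flip: matrix_pow_add)
      then have "matrix_pow B n $ i $ j = (\<Sum>l\<in>UNIV. matrix_pow B k $ i $ l * matrix_pow B (n - k) $ l $ j)"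
        by (simp add: matrix_matrix_mult_def)
      then show "(\<Sum>l\<in>UNIV. ?f l k * ?g l (n - k)) = of_real (F $$ k * G $$ (n - k)) * matrix_pow B n $ i $ j"
        by (simp add: sum_distrib_left mult_ac)
    qed
    finally show ?thesis by (simp add: fps_mult_nth atMost_atLeast0 sum_distrib_right)
  qed
  ultimately show "(\<lambda>n. of_real ((F * G) $$ n) * matrix_pow B n $ i $ j) sums ((fps_eval F ** fps_eval G) $ i $ j)"
    by (simp add: matrix_matrix_mult_def)
qed

lemma fps_eval_power: "abs_convergent F \<Longrightarrow> fps_eval (F ^ k) = matrix_pow (fps_eval F) k"
  by (induction k) (simp_all add: fps_eval_mult abs_convergent_power)

lemma fps_eval_commute:
  assumes "abs_convergent F" and "X ** B = B ** X"
  shows "X ** fps_eval F = fps_eval F ** X"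
proof -
  have comm: "X ** matrix_pow B n = matrix_pow B n ** X" for n
    using matrix_pow_commute[of B X n] assms(2) by simp
  have "(X ** fps_eval F) $ i $ j = (fps_eval F ** X) $ i $ j" for i j
  proof (rule sums_unique2)
    show "(\<lambda>n. \<Sum>l\<in>UNIV. X $ i $ l * (of_real (F $$ n) * matrix_pow B n $ l $ j)) sums ((X ** fps_eval F) $ i $ j)"
      unfolding matrix_matrix_mult_def vec_lambda_beta by (intro sums_sum sums_mult fps_eval_sums assms(1))
    have "(\<lambda>n. \<Sum>l\<in>UNIV. of_real (F $$ n) * matrix_pow B n $ i $ l * X $ l $ j) sums ((fps_eval F ** X) $ i $ j)"
      unfolding matrix_matrix_mult_def vec_lambda_beta by (intro sums_sum sums_mult2 fps_eval_sums assms(1))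
    moreover have "(\<Sum>l\<in>UNIV. of_real (F $$ n) * matrix_pow B n $ i $ l * X $ l $ j)
        = (\<Sum>l\<in>UNIV. X $ i $ l * (of_real (F $$ n) * matrix_pow B n $ l $ j))" for n
      using arg_cong[OF comm[of n], of "\<lambda>M. of_real (F $$ n) * M $ i $ j"]
      by (simp add: matrix_matrix_mult_def sum_distrib_left mult_ac)
    ultimately show "(\<lambda>n. \<Sum>l\<in>UNIV. X $ i $ l * (of_real (F $$ n) * matrix_pow B n $ l $ j)) sums ((fps_eval F ** X) $ i $ j)"
      by simp
  qed
  then show ?thesis by (simp add: vec_eq_iff)
qed

text \<open>Identifies the eigenvalue of \<open>F(B)\<close> as \<open>F(l)\<close>, by reading the
  vector equation at a nonzero component of \<open>w\<close>.\<close>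

lemma fps_eval_eigenvector:
  assumes "abs_convergent F" and w: "w \<noteq> 0" "B *v w = l *s w" "fps_eval F *v w = z *s w"
  shows "(\<lambda>n. of_real (F $$ n) * l ^ n) sums z"
proof -
  obtain i where i: "w $ i \<noteq> 0" using w(1) by (auto simp: vec_eq_iff)
  have "(\<lambda>n. \<Sum>j\<in>UNIV. of_real (F $$ n) * matrix_pow B n $ i $ j * w $ j) sums ((fps_eval F *v w) $ i)"
    unfolding matrix_vector_mult_def vec_lambda_beta by (intro sums_sum sums_mult2 fps_eval_sums assms(1))
  moreover have "(\<Sum>j\<in>UNIV. of_real (F $$ n) * matrix_pow B n $ i $ j * w $ j) = of_real (F $$ n) * l ^ n * w $ i" for n
  proof -
    have "(\<Sum>j\<in>UNIV. of_real (F $$ n) * matrix_pow B n $ i $ j * w $ j) = of_real (F $$ n) * (matrix_pow B n *v w) $ i"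
      by (simp add: matrix_vector_mult_def sum_distrib_left mult_ac)
    then show ?thesis by (simp add: matrix_pow_eigenvector[OF w(2)])
  qed
  ultimately have "(\<lambda>n. of_real (F $$ n) * l ^ n * w $ i) sums (z * w $ i)"
    using w(3) by simp
  from sums_divide[OF this, of "w $ i"] show ?thesis using i by simp
qed

lemma abs_convergent_sum_scaled: "(\<And>i. i \<in> S \<Longrightarrow> abs_convergent (F i)) \<Longrightarrow> finite S \<Longrightarrow> abs_convergent (\<Sum>i\<in>S. fps_const (c i) * F i)"
proof -
  assume *: "\<And>i. i \<in> S \<Longrightarrow> abs_convergent (F i)" "finite S"
  have "summable (\<lambda>n. \<Sum>i\<in>S. \<bar>c i\<bar> * (\<bar>F i $$ n\<bar> * N B ^ n))"
    using * by (intro summable_sum summable_mult) (simp add: abs_convergent_def)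
  then show ?thesis
    unfolding abs_convergent_def
  proof (rule summable_comparison_test')
    fix n
    have "\<bar>(\<Sum>i\<in>S. fps_const (c i) * F i) $$ n\<bar> * N B ^ n \<le> (\<Sum>i\<in>S. \<bar>c i * F i $$ n\<bar>) * N B ^ n"
      unfolding fps_sum_nth fps_mult_left_const_nth by (intro mult_right_mono sum_abs) (simp add: norm_nonneg)
    then show "norm (\<bar>(\<Sum>i\<in>S. fps_const (c i) * F i) $$ n\<bar> * N B ^ n) \<le> (\<Sum>i\<in>S. \<bar>c i\<bar> * (\<bar>F i $$ n\<bar> * N B ^ n))"
      by (simp add: abs_mult norm_nonneg sum_distrib_right mult.assoc)
  qed
qed

lemma fps_eval_sum_scaled:
  assumes "\<And>i. i \<in> S \<Longrightarrow> abs_convergent (F i)" "finite S"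
  shows "fps_eval (\<Sum>i\<in>S. fps_const (c i) * F i) = (\<Sum>i\<in>S. c i *\<^sub>R fps_eval (F i))"
proof (rule fps_eval_eqI)
  show "abs_convergent (\<Sum>i\<in>S. fps_const (c i) * F i)" using assms by (rule abs_convergent_sum_scaled)
  fix a b
  have "(\<lambda>n. \<Sum>i\<in>S. c i *\<^sub>R (of_real (F i $$ n) * matrix_pow B n $ a $ b)) sums (\<Sum>i\<in>S. c i *\<^sub>R fps_eval (F i) $ a $ b)"
    using assms by (intro sums_sum sums_scaleR_right fps_eval_sums) auto
  then show "(\<lambda>n. of_real ((\<Sum>i\<in>S. fps_const (c i) * F i) $$ n) * matrix_pow B n $ a $ b)
      sums ((\<Sum>i\<in>S. c i *\<^sub>R fps_eval (F i)) $ a $ b)"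
    unfolding sum_component vector_scaleR_component
    by (simp add: fps_sum_nth sum_distrib_right scaleR_conv_of_real[where 'a = complex] mult.assoc)
qed

text \<open>Each partial sum combines powers \<open>B ^ i\<close> with \<open>i \<ge> k\<close>, of
  norm at most \<open>N B ^ k\<close>, with weights of total size at most \<open>1\<close>. The
  condition \<open>0 < k\<close> keeps out the unit matrix, whose norm may exceed
  \<open>1\<close>.\<close>

lemma norm_fps_eval_le:
  assumes F: "abs_convergent F" and low: "\<And>n. n < k \<Longrightarrow> F $$ n = 0" and k: "0 < k"
    and sum: "\<And>n. (\<Sum>i<n. \<bar>F $$ i\<bar>) \<le> 1"
  shows "N (fps_eval F) \<le> N B ^ k"
proof -
  define P where "P n = (\<Sum>i<n. (F $$ i) *\<^sub>R matrix_pow B i)" for n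
  \<comment> \<open>This bound on the norm of the remainder tends to \<open>0\<close> entry by
    entry, so the limit is taken without invoking continuity of \<open>N\<close>.\<close>
  define e where "e n = (\<Sum>i\<in>UNIV. \<Sum>j\<in>UNIV. cmod ((fps_eval F - P n) $ i $ j) * N (matrix_unit i j))" for n
  have "(\<lambda>n. P n $ i $ j) \<longlonglongrightarrow> fps_eval F $ i $ j" for i j
    using fps_eval_sums[OF F, of i j] unfolding sums_def P_def sum_component vector_scaleR_component
    by (simp add: scaleR_conv_of_real[where 'a = complex])
  then have "(\<lambda>n. (fps_eval F - P n) $ i $ j) \<longlonglongrightarrow> 0" for i j
    using tendsto_diff[OF tendsto_const, of "\<lambda>n. P n $ i $ j" "fps_eval F $ i $ j" sequentially "fps_eval F $ i $ j"] by simp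
  then have "e \<longlonglongrightarrow> (\<Sum>i\<in>UNIV. \<Sum>j\<in>UNIV. 0 * N (matrix_unit i j))"
    unfolding e_def by (intro tendsto_sum tendsto_mult tendsto_const tendsto_norm_zero)
  then have "(\<lambda>n. e n + N B ^ k) \<longlonglongrightarrow> N B ^ k"
    using tendsto_add[of e 0 sequentially "\<lambda>_. N B ^ k" "N B ^ k"] by simp
  moreover have "N (fps_eval F) \<le> e n + N B ^ k" for n
  proof -
    have "N (P n) \<le> (\<Sum>i<n. \<bar>F $$ i\<bar> * N (matrix_pow B i))"
      unfolding P_def norm_scaleR[symmetric] by (rule norm_sum)
    also have "\<dots> \<le> (\<Sum>i<n. \<bar>F $$ i\<bar> * N B ^ k)"
    proof (rule sum_mono)
      fix i
      show "\<bar>F $$ i\<bar> * N (matrix_pow B i) \<le> \<bar>F $$ i\<bar> * N B ^ k"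
      proof (cases "i < k")
        case False
        then have "N (matrix_pow B i) \<le> N B ^ i" using k by (intro norm_matrix_pow_pos) auto
        also have "\<dots> \<le> N B ^ k" using False norm_nonneg norm_B by (intro power_decreasing) auto
        finally show ?thesis by (intro mult_left_mono) auto
      qed (simp add: low)
    qed
    also have "\<dots> \<le> 1 * N B ^ k"
      unfolding sum_distrib_right[symmetric] by (intro mult_right_mono sum) (simp add: norm_nonneg)
    finally have "N (P n) \<le> N B ^ k" by simp
    moreover have "N (fps_eval F - P n) \<le> e n" unfolding e_def by (rule norm_le_sum_entries)
    ultimately show ?thesis using norm_triangle[of "fps_eval F - P n" "P n"] by simp
  qed
  ultimately show ?thesis by (intro LIMSEQ_le_const) auto
qed

end

section \<open>The error bound\<close>

lemma root_coeff_powser_sums: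
  assumes "cmod l < 1"
  shows "(\<lambda>n. of_real (root_coeff p n) * l ^ n) sums (1 - l) powr (1 / of_nat p)"
proof -
  have "of_real (root_coeff p n) * l ^ n = ((1 / of_nat p) gchoose n) * (- l) ^ n" for n
  proof -
    have "of_real (root_coeff p n) = (pochhammer (- (1 / of_nat p)) n / fact n :: complex)"
      by (simp add: root_coeff_def pochhammer_of_real[symmetric])
    \<comment> \<open>Of the two inserted signs, one belongs to the generalized binomial coefficient
      and the other to \<open>(- l) ^ n\<close>.\<close>
    then have "of_real (root_coeff p n) * l ^ n
        = ((- 1) ^ n * (- 1) ^ n) * (pochhammer (- (1 / of_nat p)) n / fact n * l ^ n)"
      by (simp flip: power_mult_distrib)
    also have "\<dots> = ((1 / of_nat p) gchoose n) * (- l) ^ n"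
      unfolding gbinomial_pochhammer power_minus[of l] by (simp only: mult_ac times_divide_eq_left times_divide_eq_right)
    finally show ?thesis .
  qed
  then show ?thesis using gen_binomial_complex[of "- l" "1 / of_nat p"] assms by simp
qed

text \<open>The point \<open>1 - l\<close> lies in the right half-plane, so its logarithm has
  imaginary part below \<open>pi / 2\<close> in modulus, and dividing by \<open>p\<close> lands in
  the sector.\<close>

lemma powr_inverse_in_sector:
  assumes "cmod l < 1" "2 \<le> p"
  defines "z \<equiv> (1 - l) powr (1 / of_nat p)"
  shows "z \<noteq> 0" "\<bar>Arg z\<bar> < pi / real p"
proof -
  have "Re l < 1" using complex_Re_le_cmod[of l] assms(1) by simp
  then have re: "0 < Re (1 - l)" by simp
  then have "1 - l \<noteq> 0" by auto
  then have z: "z = exp (Ln (1 - l) / of_nat p)" by (simp add: z_def powr_def)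
  then show "z \<noteq> 0" by simp
  have "\<bar>Im (Ln (1 - l))\<bar> < pi / 2" using Re_Ln_pos_lt[OF \<open>1 - l \<noteq> 0\<close>] re by simp
  then have im: "\<bar>Im (Ln (1 - l)) / real p\<bar> < pi / real p"
    using assms(2) pi_gt_zero by (simp add: abs_divide divide_strict_right_mono)
  moreover have "pi / real p < pi" using assms(2) by (simp add: field_simps)
  ultimately have "\<bar>Im (Ln (1 - l)) / real p\<bar> < pi" by (rule less_trans)
  then have "Ln z = Ln (1 - l) / of_nat p"
    unfolding z abs_less_iff by (intro Ln_exp) auto
  then show "\<bar>Arg z\<bar> < pi / real p"
    using im \<open>z \<noteq> 0\<close> by (simp add: Arg_eq_Im_Ln)
qed

locale schroeder_iteration = root_params p m + normed_matrix N B
  for p m :: nat and N :: "complex ^ 'n ^ 'n \<Rightarrow> real" and B +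
  assumes eigenvalue_B: "eigenvalue B l \<Longrightarrow> cmod l < 1"
begin

lemma abs_convergent_root_series: "abs_convergent (root_series p)"
proof (rule abs_convergent_bounded)
  fix n
  show "\<bar>root_series p $$ n\<bar> \<le> 1"
    using sum_neg_root_coeff_le_1[OF p_ge_2, of "{n}"] root_coeff_neg[OF p_ge_2, of n]
    by (cases "n = 0") auto
qed

text \<open>An eigenspace of the evaluated series is invariant under \<open>B\<close>, so it
  contains an eigenvector of \<open>B\<close>, with eigenvalue \<open>l\<close> say. The eigenvalue
  of the series is then \<open>(1 - l) powr (1/p)\<close>.\<close>

lemma is_principal_root_fps_eval: "is_principal_root p (mat 1 - B) (fps_eval (root_series p))"
  unfolding is_principal_root_def
proof (intro conjI allI impI)
  have "matrix_pow (fps_eval (root_series p)) p = fps_eval (1 - fps_X)"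
    using p_ge_2 by (simp add: fps_eval_power[symmetric] abs_convergent_root_series root_series_power)
  then show "matrix_pow (fps_eval (root_series p)) p = mat 1 - B" by (simp add: fps_eval_diff)
next
  fix z
  let ?H = "fps_eval (root_series p)"
  assume "eigenvalue ?H z"
  then obtain v where v: "v \<noteq> 0" "?H *v v = z *s v" by (auto simp: eigenvalue_def)
  have HB: "B ** ?H = ?H ** B" by (rule fps_eval_commute[OF abs_convergent_root_series refl])
  define S where "S = {w. ?H *v w = z *s w}"
  have "vec.subspace S"
    by (auto simp: S_def vec.subspace_def matrix_vector_right_distrib matrix_vector_mult_vector_scalar
        vector_add_ldistrib vector_smult_assoc mult.commute)
  moreover have "B *v w \<in> S" if "w \<in> S" for w
  proof -
    have "?H *v (B *v w) = B *v (?H *v w)" by (simp add: matrix_vector_mul_assoc HB)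
    then show ?thesis using that by (simp add: S_def matrix_vector_mult_vector_scalar)
  qed
  ultimately obtain w l where w: "w \<in> S" "w \<noteq> 0" "B *v w = l *s w"
    using invariant_subspace_eigenvector[of S B v] v by (auto simp: S_def)
  have l: "cmod l < 1" using w(2,3) by (intro eigenvalue_B) (auto simp: eigenvalue_def)
  have "(\<lambda>n. of_real (root_series p $$ n) * l ^ n) sums z"
    using w by (intro fps_eval_eigenvector abs_convergent_root_series) (auto simp: S_def)
  then have "z = (1 - l) powr (1 / of_nat p)"
    using root_coeff_powser_sums[OF l] by (simp add: sums_unique2)
  then show "z \<noteq> 0" "\<bar>Arg z\<bar> < pi / real p"
    using powr_inverse_in_sector[OF l p_ge_2] by simp_all
qed

text \<open>A principal root commutes with its p-th power \<open>I - B\<close>, hence with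
  \<open>B\<close> and with every series in \<open>B\<close>; uniqueness among commuting roots then
  suffices.\<close>

lemma principal_root_eq: "principal_root p (mat 1 - B) = fps_eval (root_series p)"
  unfolding principal_root_def
proof (rule the_equality)
  fix X
  assume X: "is_principal_root p (mat 1 - B) X"
  then have A: "matrix_pow X p = mat 1 - B" by (simp add: is_principal_root_def)
  have "X ** (mat 1 - B) = (mat 1 - B) ** X"
    using matrix_pow_commute[of X X p] unfolding A by simp
  then have "X ** B = B ** X" by (simp add: matrix_mult_diff_distrib)
  then have "X ** fps_eval (root_series p) = fps_eval (root_series p) ** X"
    by (rule fps_eval_commute[OF abs_convergent_root_series])
  then show "X = fps_eval (root_series p)"
    using p_ge_2 by (intro commuting_principal_roots_eq[OF X is_principal_root_fps_eval]) auto
qed (rule is_principal_root_fps_eval)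

section \<open>The matrix iterates as series in \<open>B\<close>\<close>

lemma abs_convergent_schroeder_fps: "abs_convergent (schroeder_fps k)"
  by (rule abs_convergent_bounded[OF abs_schroeder_fps_nth_le_1])

text \<open>The coefficient bound is available for \<open>1 / x_k ^ p\<close>; multiplying by
  \<open>x_k ^ (p - 1)\<close> gives \<open>1 / x_k\<close>.\<close>

lemma abs_convergent_inverse_schroeder_fps: "abs_convergent (inverse (schroeder_fps k))"
proof -
  have "inverse (schroeder_fps k) ^ p = inverse (schroeder_fps k) ^ (p - 1) * inverse (schroeder_fps k)"
    using p_ge_2 by (simp flip: power_Suc2)
  then have "schroeder_fps k ^ (p - 1) * inverse (schroeder_fps k) ^ p = (schroeder_fps k * inverse (schroeder_fps k)) ^ (p - 1) * inverse (schroeder_fps k)"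
    by (simp only: power_mult_distrib mult.assoc)
  also have "\<dots> = inverse (schroeder_fps k)" by (simp add: inverse_mult_eq_1')
  finally show ?thesis
    using abs_convergent_mult[OF abs_convergent_power[OF abs_convergent_schroeder_fps] abs_convergent_bounded[OF abs_inverse_schroeder_fps_power_nth_le_1]] by metis
qed

lemma abs_convergent_residual_fps: "abs_convergent (residual_fps k)"
  unfolding residual_fps_def by (intro abs_convergent_diff abs_convergent_mult abs_convergent_power abs_convergent_inverse_schroeder_fps abs_convergent_1 abs_convergent_fps_X)

text \<open>Convergence of the inverse series at \<open>B\<close> shows that the iterate is
  nonsingular, so \<open>matrix_inv\<close> is a genuine inverse here.\<close>

lemma residual_fps_eval: "residual p (mat 1 - B) (fps_eval (schroeder_fps k)) = fps_eval (residual_fps k)"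
proof -
  have "matrix_inv (fps_eval (schroeder_fps k)) = fps_eval (inverse (schroeder_fps k))"
    by (rule matrix_inv_eqI)
      (simp_all add: fps_eval_mult[symmetric] abs_convergent_schroeder_fps abs_convergent_inverse_schroeder_fps inverse_mult_eq_1 inverse_mult_eq_1')
  then show ?thesis
    by (simp add: residual_def residual_fps_def fps_eval_diff fps_eval_mult fps_eval_power abs_convergent_diff abs_convergent_mult abs_convergent_power abs_convergent_inverse_schroeder_fps)
qed

text \<open>As \<open>T\<close> is a polynomial, the composition is a finite sum of powers, to which
  the evaluation rules for sums and products apply.\<close>

lemma T_compose: "T oo residual_fps k = (\<Sum>i\<le>m. fps_const (root_coeff p i) * residual_fps k ^ i)"
proof -
  have "T = (\<Sum>i\<le>m. fps_const (root_coeff p i) * fps_X ^ i)"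
    by (rule fps_ext) (auto simp: fps_sum_nth if_distrib cong: if_cong)
  then have "T oo residual_fps k = (\<Sum>i\<le>m. fps_const (root_coeff p i) * fps_X ^ i) oo residual_fps k"
    by simp
  also have "\<dots> = (\<Sum>i\<le>m. fps_const (root_coeff p i) * residual_fps k ^ i)"
    unfolding fps_compose_sum_distrib
    by (intro sum.cong refl) (simp add: fps_compose_mult_distrib fps_X_power_compose)
  finally show ?thesis .
qed

lemma schroeder_eq_fps_eval: "schroeder p m (mat 1 - B) k = fps_eval (schroeder_fps k)"
proof (induction k)
  case (Suc k)
  have "fps_eval (T oo residual_fps k) = root_taylor p m (fps_eval (residual_fps k))"
    unfolding T_compose root_taylor_def
    by (simp add: fps_eval_sum_scaled abs_convergent_power abs_convergent_residual_fps fps_eval_power)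
  moreover have "abs_convergent (T oo residual_fps k)"
    unfolding T_compose by (intro abs_convergent_sum_scaled abs_convergent_power abs_convergent_residual_fps) simp
  ultimately show ?case
    by (simp add: Suc residual_fps_eval schroeder_fps_Suc fps_eval_mult abs_convergent_schroeder_fps)
qed simp

text \<open>The error coefficients lie between \<open>0\<close> and \<open>- root_coeff p i\<close>
  for \<open>i > 0\<close> and vanish below \<open>(m + 1) ^ k\<close>, so their absolute values sum
  to at most \<open>1\<close>.\<close>

lemma norm_schroeder_diff_le:
  "N (schroeder p m (mat 1 - B) k - principal_root p (mat 1 - B)) \<le> N B ^ ((m + 1) ^ k)"
proof -
  let ?D = "schroeder_fps k - root_series p"
  have "N (fps_eval ?D) \<le> N B ^ ((m + 1) ^ k)"
  proof (rule norm_fps_eval_le)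
    show "abs_convergent ?D" by (intro abs_convergent_diff abs_convergent_schroeder_fps abs_convergent_root_series)
    show "?D $$ n = 0" if "n < (m + 1) ^ k" for n
      using schroeder_fps_nth_eq_root_coeff[OF that] by simp
    show "(\<Sum>i<n. \<bar>?D $$ i\<bar>) \<le> 1" for n
    proof -
      have "(\<Sum>i<n. \<bar>?D $$ i\<bar>) = (\<Sum>i\<in>{0<..<n}. \<bar>?D $$ i\<bar>)"
        by (intro sum.mono_neutral_right) auto
      also have "\<dots> \<le> (\<Sum>i\<in>{0<..<n}. - root_coeff p i)"
      proof (rule sum_mono)
        fix i
        assume "i \<in> {0<..<n}"
        then show "\<bar>?D $$ i\<bar> \<le> - root_coeff p i"
          using root_coeff_le_schroeder_fps_nth[of i k] schroeder_fps_nth_nonpos[of i k] by simp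
      qed
      also have "\<dots> \<le> 1" by (intro sum_neg_root_coeff_le_1 p_ge_2) auto
      finally show ?thesis .
    qed
  qed simp
  then show ?thesis
    by (simp add: schroeder_eq_fps_eval principal_root_eq fps_eval_diff abs_convergent_schroeder_fps abs_convergent_root_series)
qed

end

theorem theorem8:
  fixes A B :: "complex ^ 'n ^ 'n" and N :: "complex ^ 'n ^ 'n \<Rightarrow> real" and p m :: nat
  assumes "p \<ge> 2" and "m \<ge> 1"
    and "\<And>z. eigenvalue A z \<Longrightarrow> cmod (z - 1) < 1"
    and "A = mat 1 - B"
    and "matrix_norm N"
    and "N B < 1"
  shows "\<forall>k. N (schroeder p m A k - principal_root p A) \<le> N B ^ ((m + 1) ^ k)"
proof -
  have "cmod l < 1" if l: "eigenvalue B l" for l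
  proof -
    obtain v where "v \<noteq> 0" "B *v v = l *s v" using l by (auto simp: eigenvalue_def)
    then have "v \<noteq> 0" "A *v v = (1 - l) *s v"
      using assms(4) by (simp_all add: matrix_vector_mult_diff_rdistrib vector_sub_rdistrib)
    then show ?thesis using assms(3)[of "1 - l"] by (auto simp: eigenvalue_def)
  qed
  then interpret schroeder_iteration p m N B
    by unfold_locales (use assms in auto)
  show ?thesis using norm_schroeder_diff_le assms(4) by simp
qed

end
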